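(* Let $G$ be a compact group. For every stratifiable $G$-space $Y$ and every closed invariant subset $X\subset Y$ there exists a regular continuous extension operator $T:C_{inv}(X\times X)\to C_{inv}(Y\times Y)$ preserving the class of invariant pseudometrics (that is, $T(p)$ is an invariant pseudometric on $Y$ whenever $p\in C_{inv}(X\times X)$ is a pseudometric on $X$). Moreover, if the group $G$ is finite, then the operator $T$ is continuous with respect to the pointwise convergence of functions.
   Context: A Hausdorff space $Y$ is stratifiable if to every open set $U\subset Y$ one can assign a sequence $\{U_n\}_{n=1}^\infty$ of open subsets of $Y$ such that (a) $\overline{U_n}\subset U$, (b) $\bigcup_{n=1}^\infty U_n=U$, and (c) $U_n\subset V_n$ for all $n$ whenever $U\subset V$ are open. $G$ is a compact topological group; a $G$-space is a topological space with a continuous left action of $G$; a subset $X$ is invariant if $gx\in X$ for all $g\in G$, $x\in X$. For a $G$-space $Z$, $C(Z\times Z)$ is the linear lattice of continuous real-valued functions on $Z\times Z$ equipped with the compact-open topology, and $C_{inv}(Z\times Z)=\{f\in C(Z\times Z): f(gx,gy)=f(x,y)\text{ for all }g\in G,\ x,y\in Z\}$ is its linear subspace of continuous invariant functions. "Continuous" for $T$ refers to the compact-open topologies unless otherwise stated. $T$ is an extension operator if $T(p)|_{X\times X}=p$ for every $p$; it is regular if it is linear, positive ($p\ge0$ implies $T(p)\ge0$) and maps the constant unit function to the constant unit function. *)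

theory Defs
  imports "HOL-Analysis.Analysis" "HOL-Algebra.Group_Action"
begin

text \<open>The defining sequence is indexed from 0 rather than from 1.\<close>

definition stratifiable_space :: "'a topology \<Rightarrow> bool" where
  "stratifiable_space Y \<longleftrightarrow>
     Hausdorff_space Y \<and>
     (\<exists>S :: 'a set \<Rightarrow> nat \<Rightarrow> 'a set.
        (\<forall>U n. openin Y U \<longrightarrow> openin Y (S U n) \<and> Y closure_of (S U n) \<subseteq> U) \<and>
        (\<forall>U. openin Y U \<longrightarrow> (\<Union>n. S U n) = U) \<and>
        (\<forall>U V n. openin Y U \<and> openin Y V \<and> U \<subseteq> V \<longrightarrow> S U n \<subseteq> S V n))"

text \<open>No separation axiom is imposed on the group topology.\<close>

definition topological_group :: "('g, 'm) monoid_scheme \<Rightarrow> 'g topology \<Rightarrow> bool" where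
  "topological_group G TG \<longleftrightarrow>
     group G \<and> topspace TG = carrier G \<and>
     continuous_map (prod_topology TG TG) TG (\<lambda>(g, h). g \<otimes>\<^bsub>G\<^esub> h) \<and>
     continuous_map TG TG (\<lambda>g. inv\<^bsub>G\<^esub> g)"

definition G_space ::
  "('g, 'm) monoid_scheme \<Rightarrow> 'g topology \<Rightarrow> ('g \<Rightarrow> 'a \<Rightarrow> 'a) \<Rightarrow> 'a topology \<Rightarrow> bool" where
  "G_space G TG \<phi> Y \<longleftrightarrow>
     group_action G (topspace Y) \<phi> \<and>
     continuous_map (prod_topology TG Y) Y (\<lambda>(g, y). \<phi> g y)"

definition invariant_subset ::
  "('g, 'm) monoid_scheme \<Rightarrow> ('g \<Rightarrow> 'a \<Rightarrow> 'a) \<Rightarrow> 'a set \<Rightarrow> bool" where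
  "invariant_subset G \<phi> X \<longleftrightarrow> (\<forall>g \<in> carrier G. \<forall>x \<in> X. \<phi> g x \<in> X)"

text \<open>
  Functions are taken extensional (\<open>undefined\<close> off the domain), so that equality of elements of
  a function space is equality on the domain, and so that these spaces are subsets of the
  carrier of a \<^const>\<open>product_topology\<close>.
\<close>

definition cont_real :: "'a topology \<Rightarrow> ('a \<Rightarrow> real) set" where
  "cont_real W = {f \<in> extensional (topspace W). continuous_map W euclideanreal f}"

definition C_inv ::
  "('g, 'm) monoid_scheme \<Rightarrow> ('g \<Rightarrow> 'a \<Rightarrow> 'a) \<Rightarrow> 'a topology \<Rightarrow> ('a \<times> 'a \<Rightarrow> real) set" where
  "C_inv G \<phi> Z =
     {f \<in> cont_real (prod_topology Z Z).
        \<forall>g \<in> carrier G. \<forall>x \<in> topspace Z. \<forall>y \<in> topspace Z. f (\<phi> g x, \<phi> g y) = f (x, y)}"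

definition compact_open_topology :: "'a topology \<Rightarrow> ('a \<Rightarrow> real) topology" where
  "compact_open_topology W =
     topology_generated_by
       {{f \<in> cont_real W. f ` K \<subseteq> U} | K U. compactin W K \<and> open U}"

definition pointwise_topology :: "'a topology \<Rightarrow> ('a \<Rightarrow> real) topology" where
  "pointwise_topology W =
     subtopology (product_topology (\<lambda>_. euclideanreal) (topspace W)) (cont_real W)"

definition C_inv_co ::
  "('g, 'm) monoid_scheme \<Rightarrow> ('g \<Rightarrow> 'a \<Rightarrow> 'a) \<Rightarrow> 'a topology \<Rightarrow> ('a \<times> 'a \<Rightarrow> real) topology" where
  "C_inv_co G \<phi> Z = subtopology (compact_open_topology (prod_topology Z Z)) (C_inv G \<phi> Z)"

definition C_inv_pw ::
  "('g, 'm) monoid_scheme \<Rightarrow> ('g \<Rightarrow> 'a \<Rightarrow> 'a) \<Rightarrow> 'a topology \<Rightarrow> ('a \<times> 'a \<Rightarrow> real) topology" where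
  "C_inv_pw G \<phi> Z = subtopology (pointwise_topology (prod_topology Z Z)) (C_inv G \<phi> Z)"

lemma topspace_compact_open_topology: "topspace (compact_open_topology W) = cont_real W"
proof -
  have "cont_real W \<in> {{f \<in> cont_real W. f ` K \<subseteq> U} | K U. compactin W K \<and> open U}"
    by (rule CollectI, rule exI[of _ "{}"], rule exI[of _ UNIV]) auto
  then show ?thesis
    unfolding compact_open_topology_def topology_generated_by_topspace by blast
qed

lemma topspace_pointwise_topology: "topspace (pointwise_topology W) = cont_real W"
  by (auto simp: pointwise_topology_def cont_real_def PiE_def)

lemma topspace_C_inv_co: "topspace (C_inv_co G \<phi> Z) = C_inv G \<phi> Z"
  by (auto simp: C_inv_co_def topspace_compact_open_topology C_inv_def)

lemma topspace_C_inv_pw: "topspace (C_inv_pw G \<phi> Z) = C_inv G \<phi> Z"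
  by (auto simp: C_inv_pw_def topspace_pointwise_topology C_inv_def)

definition pseudometric_on :: "'a set \<Rightarrow> ('a \<times> 'a \<Rightarrow> real) \<Rightarrow> bool" where
  "pseudometric_on A d \<longleftrightarrow>
     (\<forall>x \<in> A. \<forall>y \<in> A. 0 \<le> d (x, y)) \<and>
     (\<forall>x \<in> A. d (x, x) = 0) \<and>
     (\<forall>x \<in> A. \<forall>y \<in> A. d (x, y) = d (y, x)) \<and>
     (\<forall>x \<in> A. \<forall>y \<in> A. \<forall>z \<in> A. d (x, z) \<le> d (x, y) + d (y, z))"

text \<open>
  In the next three definitions \<open>F\<close> is a set of extensional functions on \<open>D\<close>, and \<open>T\<close> sends
  its elements to extensional functions on \<open>E\<close>. Vector space operations and constants are
  restricted to \<open>D\<close> to stay extensional.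
\<close>

definition linear_operator ::
  "('a \<Rightarrow> real) set \<Rightarrow> 'a set \<Rightarrow> 'a set \<Rightarrow> (('a \<Rightarrow> real) \<Rightarrow> 'a \<Rightarrow> real) \<Rightarrow> bool" where
  "linear_operator F D E T \<longleftrightarrow>
     (\<forall>p \<in> F. \<forall>q \<in> F. T (\<lambda>z\<in>D. p z + q z) = (\<lambda>z\<in>E. T p z + T q z)) \<and>
     (\<forall>c. \<forall>p \<in> F. T (\<lambda>z\<in>D. c * p z) = (\<lambda>z\<in>E. c * T p z))"

definition regular_operator ::
  "('a \<Rightarrow> real) set \<Rightarrow> 'a set \<Rightarrow> 'a set \<Rightarrow> (('a \<Rightarrow> real) \<Rightarrow> 'a \<Rightarrow> real) \<Rightarrow> bool" where
  "regular_operator F D E T \<longleftrightarrow>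
     linear_operator F D E T \<and>
     (\<forall>p \<in> F. (\<forall>z \<in> D. 0 \<le> p z) \<longrightarrow> (\<forall>z \<in> E. 0 \<le> T p z)) \<and>
     T (\<lambda>z\<in>D. 1) = (\<lambda>z\<in>E. 1)"

definition extension_operator ::
  "('a \<Rightarrow> real) set \<Rightarrow> 'a set \<Rightarrow> (('a \<Rightarrow> real) \<Rightarrow> 'a \<Rightarrow> real) \<Rightarrow> bool" where
  "extension_operator F D T \<longleftrightarrow> (\<forall>p \<in> F. restrict (T p) D = p)"

end

theory Submission
  imports Defs
begin

text \<open>
  Every point \<open>y\<close> of \<open>Y\<close> is assigned a step function \<open>h y\<close> on \<open>[0, 1)\<close> with values in \<open>X\<close>,
  constantly \<open>x\<close> if \<open>y = x \<in> X\<close>: off \<open>X\<close>, the lengths of the steps of \<open>h y\<close> are given by a partition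
  of unity on \<open>Y - X\<close> and their values are the points of \<open>X\<close> chosen in Borges's version of the
  Dugundji extension theorem. Since distances are compared for each \<open>t\<close> separately,
  \<open>hm p (y, z) = \<integral>\<^sub>0\<^sup>1 p (h y t, h z t) dt\<close> extends \<open>p\<close> and is a pseudometric if \<open>p\<close> is one. Averaging
  \<open>hm p (g y, g z)\<close> over \<open>g \<in> G\<close> makes the extension invariant.

  The partition of unity comes from Michael's construction of a \<open>\<sigma>\<close>-disjoint open refinement out of
  iterated cushioned refinements. The invariant mean on \<open>G\<close> is Kakutani's: averages over minimal nets
  of \<open>G\<close> are almost invariant, because Hall's theorem matches a minimal net with each of its
  translates, and averages over two such nets are almost equal.
\<close>

section \<open>The invariant mean of a compact group\<close>

text \<open>Weighting \<open>p\<close> by products of two partition functions, as a direct use of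
  the Dugundji formula would suggest, generally gives a point off \<open>X\<close> a positive
  distance to itself. Using the same parameter \<open>t\<close> in both arguments removes this
  defect. Since \<open>t\<close> is integrated out, \<open>h\<close> need only be continuous in a
  sense that ignores sets of small measure. The steps are cut by stick-breaking, so the partition
  need be neither normalized nor locally finite: it is enough that near each point off
  \<open>X\<close> some partition function is constantly 1, which exhausts the stick. As
  \<open>Y\<close> may be nonmetrizable, there is no nearest point of \<open>X\<close> to choose;
  the level of Borges's neighbourhoods serves as a substitute for distance. Nothing makes
  \<open>h\<close> equivariant, so the group is averaged over last. This keeps the extension because
  \<open>X\<close> and \<open>p\<close> are invariant, and it asks of the mean only positivity,
  linearity, normalization and invariance under right translation, on continuous functions.
  Continuity in the compact-open topology holds because over a compact set \<open>h\<close> takes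
  its values in a compact set.\<close>

lemma hall_marriage:
  fixes N :: "'a \<Rightarrow> 'b set"
  assumes "finite A" and "\<And>x. x \<in> A \<Longrightarrow> finite (N x)"
    and "\<And>B. B \<subseteq> A \<Longrightarrow> card B \<le> card (\<Union>(N ` B))"
  shows "\<exists>m. inj_on m A \<and> (\<forall>x\<in>A. m x \<in> N x)"
  using assms
proof (induction "card A" arbitrary: A N rule: less_induct)
  case less
  show ?case
  proof (cases "A = {}")
    case True
    then show ?thesis by simp
  next
    case False
    then obtain x where x: "x \<in> A" by blast
    show ?thesis
    \<comment> \<open>If some proper nonempty \<open>B\<close> has no spare neighbours, it must use
      up all of them, and \<open>A - B\<close> is matched with what remains. Otherwise every such
      subset has a spare neighbour, so one arbitrary match can be made first.\<close>
    proof (cases "\<exists>B. B \<subset> A \<and> B \<noteq> {} \<and> card (\<Union>(N ` B)) = card B")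
      case True
      then obtain B where B: "B \<subset> A" "B \<noteq> {}" and eq: "card (\<Union>(N ` B)) = card B" by blast
      have fB: "finite B" using B less.prems(1) finite_subset by blast
      let ?M = "\<Union>(N ` B)"
      have fM: "finite ?M" using fB B less.prems(2) by blast
      have "\<exists>m. inj_on m B \<and> (\<forall>x\<in>B. m x \<in> N x)"
        using B fB less.prems psubset_card_mono[of A B] by (intro less.hyps) auto
      then obtain m1 where m1: "inj_on m1 B" "\<forall>x\<in>B. m1 x \<in> N x" by blast
      have "\<exists>m. inj_on m (A - B) \<and> (\<forall>x\<in>A - B. m x \<in> N x - ?M)"
      proof (rule less.hyps)
        show "card (A - B) < card A"
          using B less.prems(1) by (intro psubset_card_mono) auto
        show "finite (A - B)" using less.prems(1) by simp
        show "finite (N x - ?M)" if "x \<in> A - B" for x using that less.prems(2) by simp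
        \<comment> \<open>Hall's condition for \<open>C\<close> after removing \<open>?M\<close>
          comes from the one for \<open>C \<union> B\<close>, since \<open>B\<close> accounts for
          exactly \<open>card ?M\<close>.\<close>
        show "card C \<le> card (\<Union>((\<lambda>x. N x - ?M) ` C))" if C: "C \<subseteq> A - B" for C
        proof -
          have fC: "finite C" using C less.prems(1) finite_subset by blast
          have "card C + card B = card (C \<union> B)"
            using C fB fC by (subst card_Un_disjoint) auto
          also have "\<dots> \<le> card (\<Union>(N ` (C \<union> B)))"
            using C B by (intro less.prems(3)) auto
          also have "\<Union>(N ` (C \<union> B)) = \<Union>((\<lambda>x. N x - ?M) ` C) \<union> ?M" by auto
          also have "card \<dots> \<le> card (\<Union>((\<lambda>x. N x - ?M) ` C)) + card ?M"
            by (rule card_Un_le)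
          finally show ?thesis using eq by simp
        qed
      qed
      then obtain m2 where m2: "inj_on m2 (A - B)" "\<forall>x\<in>A - B. m2 x \<in> N x - ?M" by blast
      have "inj_on (\<lambda>x. if x \<in> B then m1 x else m2 x) A"
      proof (rule inj_onI)
        fix u v assume uv: "u \<in> A" "v \<in> A"
          and e: "(if u \<in> B then m1 u else m2 u) = (if v \<in> B then m1 v else m2 v)"
        have 1: "m1 w \<in> ?M" if "w \<in> B" for w using m1 that by blast
        have 2: "m2 w \<notin> ?M" if "w \<in> A - B" for w using m2 that by blast
        show "u = v"
        proof (cases "u \<in> B"; cases "v \<in> B")
          assume "u \<in> B" "v \<in> B"
          then show ?thesis using e inj_onD[OF m1(1)] by auto
        next
          assume "u \<in> B" "v \<notin> B"
          then show ?thesis using e uv 1[of u] 2[of v] by auto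
        next
          assume "u \<notin> B" "v \<in> B"
          then show ?thesis using e uv 1[of v] 2[of u] by auto
        next
          assume "u \<notin> B" "v \<notin> B"
          then show ?thesis using e uv inj_onD[OF m2(1)] by auto
        qed
      qed
      then show ?thesis using m1 m2 by (intro exI[of _ "\<lambda>x. if x \<in> B then m1 x else m2 x"]) auto
    next
      case False
      have "card {x} \<le> card (\<Union>(N ` {x}))" using x by (intro less.prems(3)) auto
      then have "N x \<noteq> {}" by auto
      then obtain y where y: "y \<in> N x" by blast
      have "\<exists>m. inj_on m (A - {x}) \<and> (\<forall>z\<in>A - {x}. m z \<in> N z - {y})"
      proof (rule less.hyps)
        show "card (A - {x}) < card A" using x less.prems(1) by (intro psubset_card_mono) auto
        \<comment> \<open>A nonempty \<open>C\<close> avoiding \<open>x\<close> is a proper subset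
          of \<open>A\<close>, so it has a neighbour to spare and tolerates the loss of
          \<open>y\<close>.\<close>
        show "card C \<le> card (\<Union>((\<lambda>x. N x - {y}) ` C))" if C: "C \<subseteq> A - {x}" for C
        proof (cases "C = {}")
          case nonempty: False
          have "card C \<le> card (\<Union>(N ` C))" using C by (intro less.prems(3)) auto
          moreover have "C \<subset> A" using C x by blast
          ultimately have "card C < card (\<Union>(N ` C))"
            using False nonempty by (metis le_neq_implies_less)
          moreover have "\<Union>((\<lambda>x. N x - {y}) ` C) = \<Union>(N ` C) - {y}" by auto
          ultimately show ?thesis using card_Diff1_le[of "\<Union>(N ` C)" y]
            by (simp add: card_Diff_singleton_if) linarith
        qed simp
      qed (use less.prems in auto)
      then obtain m where m: "inj_on m (A - {x})" "\<forall>z\<in>A - {x}. m z \<in> N z - {y}" by blast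
      have "inj_on (m(x := y)) A"
      proof (rule inj_onI)
        fix u v assume uv: "u \<in> A" "v \<in> A" and e: "(m(x := y)) u = (m(x := y)) v"
        have 1: "m w \<noteq> y" if "w \<in> A" "w \<noteq> x" for w using m that by blast
        show "u = v"
          using uv e 1[of u] 1[of v] inj_onD[OF m(1), of u v] by (cases "u = x"; cases "v = x") auto
      qed
      then show ?thesis using m y by (intro exI[of _ "m(x := y)"]) auto
    qed
  qed
qed

section \<open>Continuity estimates for real functions\<close>

lemma openin_Inter_finite:
  assumes "finite J" "\<And>j. j \<in> J \<Longrightarrow> openin Y (N j)"
  shows "openin Y (topspace Y \<inter> (\<Inter>j\<in>J. N j))"
proof -
  have "openin Y (\<Inter>(insert (topspace Y) (N ` J)))"
    using assms by (intro openin_Inter) auto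
  then show ?thesis by simp
qed

lemma continuous_map_real_iff:
  "continuous_map Z euclideanreal f \<longleftrightarrow>
     (\<forall>x\<in>topspace Z. \<forall>e>0. \<exists>U. openin Z U \<and> x \<in> U \<and> (\<forall>y\<in>U. \<bar>f y - f x\<bar> < e))"
  using Met_TC.continuous_map_to_metric[of Z f]
  by (simp add: dist_real_def abs_minus_commute)

text \<open>The points where \<open>F\<close> deviates by less than \<open>e\<close> from its value
  over \<open>z\<close> form an open set containing the whole slice over \<open>z\<close>, so the
  tube lemma applies.\<close>

lemma continuous_map_compact_uniform:
  fixes F :: "'k \<times> 'z \<Rightarrow> real"
  assumes K: "compact_space K" and F: "continuous_map (prod_topology K Z) euclideanreal F"
    and z: "z \<in> topspace Z" and "e > 0"
  obtains N where "openin Z N" "z \<in> N" "\<And>k w. k \<in> topspace K \<Longrightarrow> w \<in> N \<Longrightarrow> \<bar>F (k, w) - F (k, z)\<bar> < e"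
proof -
  have *: "continuous_map (prod_topology K Z) (prod_topology K Z) (\<lambda>w. (fst w, z))"
    using z by (intro continuous_map_pairedI) (auto simp: continuous_map_fst)
  have "continuous_map (prod_topology K Z) euclideanreal (\<lambda>w. \<bar>F w - F (fst w, z)\<bar>)"
    using continuous_map_compose[OF * F] F
    by (intro continuous_map_real_abs continuous_map_diff) (auto simp: o_def)
  then have W: "openin (prod_topology K Z)
      {w \<in> topspace (prod_topology K Z). \<bar>F w - F (fst w, z)\<bar> \<in> {..<e}}"
    by (rule openin_continuous_map_preimage) auto
  have "compactin K (topspace K)" using K by (simp add: compact_space_def)
  moreover have "topspace K \<times> {z} \<subseteq>
      {w \<in> topspace (prod_topology K Z). \<bar>F w - F (fst w, z)\<bar> \<in> {..<e}}"
    using z \<open>e > 0\<close> by auto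
  ultimately have "\<exists>U V. openin K U \<and> openin Z V \<and> topspace K \<subseteq> U \<and> z \<in> V \<and>
      U \<times> V \<subseteq> {w \<in> topspace (prod_topology K Z). \<bar>F w - F (fst w, z)\<bar> \<in> {..<e}}"
    by (intro tube_lemma_left[OF W _ z])
  then obtain U V where "openin Z V" "topspace K \<subseteq> U" "z \<in> V"
      "U \<times> V \<subseteq> {w \<in> topspace (prod_topology K Z). \<bar>F w - F (fst w, z)\<bar> \<in> {..<e}}"
    by blast
  then show thesis
  proof (intro that[of V])
    fix k w assume "k \<in> topspace K" "w \<in> V"
    then have "(k, w) \<in> U \<times> V" using \<open>topspace K \<subseteq> U\<close> by blast
    then show "\<bar>F (k, w) - F (k, z)\<bar> < e"
      using \<open>U \<times> V \<subseteq> _\<close> by auto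
  qed
qed

lemma eq_if_arbitrarily_close:
  fixes x y :: real
  assumes "\<And>e. e > 0 \<Longrightarrow> \<bar>x - y\<bar> \<le> e"
  shows "x = y"
proof -
  have "\<bar>x - y\<bar> \<le> 0" by (rule field_le_epsilon) (simp add: assms)
  then show ?thesis by simp
qed

section \<open>Averages over finite sets\<close>

definition avg :: "'g set \<Rightarrow> ('g \<Rightarrow> real) \<Rightarrow> real" where
  "avg A f = (\<Sum>a\<in>A. f a) / card A"

lemma avg_add: "avg A (\<lambda>g. f g + k g) = avg A f + avg A k"
  by (simp add: avg_def sum.distrib add_divide_distrib)

lemma avg_cmult: "avg A (\<lambda>g. c * f g) = c * avg A f"
  by (simp add: avg_def sum_distrib_left)

lemma avg_const: "finite A \<Longrightarrow> A \<noteq> {} \<Longrightarrow> avg A (\<lambda>g. c) = c"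
  by (simp add: avg_def)

lemma avg_mono:
  assumes "\<And>a. a \<in> A \<Longrightarrow> f a \<le> k a"
  shows "avg A f \<le> avg A k"
  unfolding avg_def by (intro divide_right_mono sum_mono assms) auto

lemma avg_diff_le:
  assumes "finite A" "A \<noteq> {}" "\<And>a. a \<in> A \<Longrightarrow> \<bar>f a - k a\<bar> \<le> e"
  shows "\<bar>avg A f - avg A k\<bar> \<le> e"
proof -
  have "f a \<le> k a + e \<and> k a \<le> f a + e" if "a \<in> A" for a
    using assms(3)[OF that] by linarith
  then have "avg A f \<le> avg A (\<lambda>a. k a + e)" "avg A k \<le> avg A (\<lambda>a. f a + e)"
    by (auto intro: avg_mono)
  then show ?thesis using assms by (simp add: avg_add avg_const abs_le_iff)
qed

lemma avg_swap: "avg A (\<lambda>a. avg B (\<lambda>b. f a b)) = avg B (\<lambda>b. avg A (\<lambda>a. f a b))"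
  using sum.swap[of f B A]
  by (simp add: avg_def sum_divide_distrib[symmetric] mult.commute)

section \<open>Almost invariant averages on a compact group\<close>

locale compact_group =
  fixes G :: "('g, 'm) monoid_scheme" (structure) and TG :: "'g topology"
  assumes topological_group: "topological_group G TG" and compact: "compact_space TG"
begin

sublocale group G
  using topological_group by (simp add: topological_group_def)

lemma topspace_TG: "topspace TG = carrier G"
  using topological_group by (simp add: topological_group_def)

lemma continuous_map_mult:
  assumes "continuous_map Z TG u" "continuous_map Z TG v"
  shows "continuous_map Z TG (\<lambda>z. u z \<otimes> v z)"
proof -
  have "continuous_map (prod_topology TG TG) TG (\<lambda>(g, h). g \<otimes> h)"
    using topological_group by (simp add: topological_group_def)
  from continuous_map_compose[OF continuous_map_pairedI[OF assms] this] show ?thesis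
    by (simp add: o_def)
qed

text \<open>Translations from both sides are included because comparing two nets uses right
  translates of one and left translates of the other.\<close>

definition good :: "'g set \<Rightarrow> ('g \<Rightarrow> real) \<Rightarrow> real \<Rightarrow> bool" where
  "good A f e \<longleftrightarrow> finite A \<and> A \<noteq> {} \<and> A \<subseteq> carrier G \<and>
     (\<forall>h\<in>carrier G. \<forall>k\<in>carrier G. \<bar>avg A (\<lambda>a. f (h \<otimes> a \<otimes> k)) - avg A f\<bar> \<le> e)"

text \<open>
  The entourage \<open>near\<close> is invariant under translations from both sides, so a two-sided translate
  of a minimal net is again a minimal net; Hall's theorem matches the two nets.
\<close>

lemma exists_good:
  assumes "finite F" and F: "\<And>f. f \<in> F \<Longrightarrow> continuous_map TG euclideanreal f" and "e > 0"
  shows "\<exists>A. \<forall>f\<in>F. good A f e"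
proof -
  \<comment> \<open>Half of \<open>e\<close>, since matched points are compared through a third
    point near both.\<close>
  define near where "near x y \<longleftrightarrow> (\<forall>f\<in>F. \<forall>g\<in>carrier G. \<forall>h\<in>carrier G.
    \<bar>f (g \<otimes> x \<otimes> h) - f (g \<otimes> y \<otimes> h)\<bar> < e / 2)" for x y
  have near_trans: "near (g \<otimes> x \<otimes> h) (g \<otimes> y \<otimes> h)"
    if "near x y" "x \<in> carrier G" "y \<in> carrier G" "g \<in> carrier G" "h \<in> carrier G" for x y g h
  proof -
    have "g' \<otimes> (g \<otimes> z \<otimes> h) \<otimes> h' = (g' \<otimes> g) \<otimes> z \<otimes> (h \<otimes> h')"
      if "z \<in> carrier G" "g' \<in> carrier G" "h' \<in> carrier G" for z g' h'
      using that \<open>g \<in> carrier G\<close> \<open>h \<in> carrier G\<close> by (simp add: m_assoc)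
    then show ?thesis using that unfolding near_def by simp
  qed
  have nbhd: "\<exists>N. openin TG N \<and> x \<in> N \<and> (\<forall>y\<in>N. near x y)" if x: "x \<in> carrier G" for x
  proof -
    have "\<exists>N. openin TG N \<and> x \<in> N \<and> (\<forall>y\<in>N. \<forall>g\<in>carrier G. \<forall>h\<in>carrier G.
        \<bar>f (g \<otimes> x \<otimes> h) - f (g \<otimes> y \<otimes> h)\<bar> < e / 2)" if f: "f \<in> F" for f
    proof -
      let ?P = "prod_topology (prod_topology TG TG) TG"
      have "continuous_map ?P TG (\<lambda>w. fst (fst w) \<otimes> snd w \<otimes> snd (fst w))"
        by (intro continuous_map_mult continuous_map_snd
              continuous_map_compose[OF continuous_map_fst continuous_map_fst, unfolded o_def]
              continuous_map_compose[OF continuous_map_fst continuous_map_snd, unfolded o_def])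
      from continuous_map_compose[OF this F[OF f]]
      have c: "continuous_map ?P euclideanreal (\<lambda>w. f (fst (fst w) \<otimes> snd w \<otimes> snd (fst w)))"
        by (simp add: o_def)
      have "compact_space (prod_topology TG TG)" using compact by (simp add: compact_space_prod_topology)
      then obtain N where "openin TG N" "x \<in> N"
        "\<And>k w. k \<in> topspace (prod_topology TG TG) \<Longrightarrow> w \<in> N \<Longrightarrow>
          \<bar>f (fst k \<otimes> w \<otimes> snd k) - f (fst k \<otimes> x \<otimes> snd k)\<bar> < e / 2"
        using continuous_map_compact_uniform[OF _ c, of x "e/2"] x \<open>e > 0\<close> topspace_TG by auto
      then show ?thesis
        by (intro exI[of _ N]) (auto simp: topspace_TG abs_minus_commute)
    qed
    then obtain N where N: "\<And>f. f \<in> F \<Longrightarrow> openin TG (N f) \<and> x \<in> N f \<and>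
      (\<forall>y\<in>N f. \<forall>g\<in>carrier G. \<forall>h\<in>carrier G. \<bar>f (g \<otimes> x \<otimes> h) - f (g \<otimes> y \<otimes> h)\<bar> < e / 2)"
      by metis
    have "openin TG (topspace TG \<inter> (\<Inter>f\<in>F. N f))"
      using \<open>finite F\<close> N by (intro openin_Inter_finite) auto
    then show ?thesis using N x topspace_TG
      by (intro exI[of _ "topspace TG \<inter> (\<Inter>f\<in>F. N f)"]) (auto simp: near_def)
  qed
  define net where "net A \<longleftrightarrow> finite A \<and> A \<subseteq> carrier G \<and> (\<forall>y\<in>carrier G. \<exists>a\<in>A. near a y)" for A
  have "\<exists>A. net A"
  proof -
    obtain N where N: "\<And>x. x \<in> carrier G \<Longrightarrow> openin TG (N x) \<and> x \<in> N x \<and> (\<forall>y\<in>N x. near x y)"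
      using nbhd by metis
    have "\<forall>U\<in>N ` carrier G. openin TG U" "topspace TG \<subseteq> \<Union>(N ` carrier G)"
      using N by (auto simp: topspace_TG)
    then have "\<exists>\<F>. finite \<F> \<and> \<F> \<subseteq> N ` carrier G \<and> topspace TG \<subseteq> \<Union>\<F>"
      using compact unfolding compact_space_alt by meson
    then obtain \<F> where "finite \<F>" "\<F> \<subseteq> N ` carrier G" "topspace TG \<subseteq> \<Union>\<F>" by blast
    then obtain A where A: "finite A" "A \<subseteq> carrier G" "\<F> = N ` A"
      using finite_subset_image[of \<F> N "carrier G"] by auto
    have "\<exists>a\<in>A. near a y" if "y \<in> carrier G" for y
    proof -
      have "y \<in> \<Union>(N ` A)"
        using that A \<open>topspace TG \<subseteq> \<Union>\<F>\<close> by (auto simp: topspace_TG)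
      then obtain a where "a \<in> A" "y \<in> N a" by blast
      then show ?thesis using N A by blast
    qed
    then have "net A" using A by (simp add: net_def)
    then show ?thesis by blast
  qed
  then obtain A where A: "net A" and min: "\<And>B. net B \<Longrightarrow> card A \<le> card B"
    using ex_has_least_nat[of net _ card] by metis
  then have fA: "finite A" "A \<subseteq> carrier G" by (auto simp: net_def)
  have "A \<noteq> {}" using A unfolding net_def by auto
  have "\<bar>avg A (\<lambda>a. f (h \<otimes> a \<otimes> k)) - avg A f\<bar> \<le> e"
    if f: "f \<in> F" and h: "h \<in> carrier G" and k: "k \<in> carrier G" for f h k
  proof -
    define \<tau> where "\<tau> a = h \<otimes> a \<otimes> k" for a
    have \<tau>: "inj_on \<tau> A"
    proof (rule inj_onI)
      fix a b assume "a \<in> A" "b \<in> A" and eq: "\<tau> a = \<tau> b"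
      then have ab: "a \<in> carrier G" "b \<in> carrier G" using fA by auto
      then have "h \<otimes> a = h \<otimes> b" using eq h k unfolding \<tau>_def by (metis m_closed right_cancel)
      then show "a = b" using ab h by (metis Units_eq Units_l_cancel)
    qed
    have near\<tau>: "\<exists>a\<in>A. near (\<tau> a) y" if y: "y \<in> carrier G" for y
    proof -
      obtain a where a: "a \<in> A" "near a (inv h \<otimes> y \<otimes> inv k)"
        using A y h k unfolding net_def by blast
      have "h \<otimes> (inv h \<otimes> y \<otimes> inv k) \<otimes> k = y"
      proof -
        have "h \<otimes> (inv h \<otimes> y) = y" using m_assoc[of h "inv h" y] y h by simp
        then show ?thesis using y h k by (simp add: m_assoc)
      qed
      then have "near (\<tau> a) y"
        using near_trans[OF a(2), of h k] a fA y h k by (auto simp: \<tau>_def)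
      then show ?thesis using a by blast
    qed
    \<comment> \<open>\<open>near\<close> need not be transitive, so two net points count as
      neighbours when they share a near point.\<close>
    define N where "N a = {b \<in> \<tau> ` A. \<exists>y\<in>carrier G. near a y \<and> near b y}" for a
    have "\<exists>m. inj_on m A \<and> (\<forall>a\<in>A. m a \<in> N a)"
    proof (rule hall_marriage)
      fix B assume B: "B \<subseteq> A"
      have fN: "finite (\<Union>(N ` B))"
        using B fA by (auto simp: N_def intro: finite_subset)
      \<comment> \<open>Exchanging \<open>B\<close> for its neighbours leaves a net: a point near
        some member of \<open>B\<close> is also near a translate, which is then a neighbour of that
        member. Minimality of \<open>A\<close> now gives Hall's condition.\<close>
      have "net ((A - B) \<union> \<Union>(N ` B))"
        unfolding net_def
      proof (intro conjI ballI)
        show "finite (A - B \<union> \<Union> (N ` B))" using fA fN by blast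
        show "A - B \<union> \<Union> (N ` B) \<subseteq> carrier G"
          using fA h k by (auto simp: N_def \<tau>_def)
        fix y assume y: "y \<in> carrier G"
        obtain a where a: "a \<in> A" "near a y" using A y unfolding net_def by blast
        obtain b where b: "b \<in> A" "near (\<tau> b) y" using near\<tau> y by blast
        show "\<exists>a\<in>A - B \<union> \<Union> (N ` B). near a y"
        proof (cases "a \<in> B")
          case True
          then have "\<tau> b \<in> \<Union>(N ` B)" using a b y unfolding N_def by blast
          then show ?thesis using b by blast
        qed (use a in blast)
      qed
      then have "card A \<le> card ((A - B) \<union> \<Union>(N ` B))" by (rule min)
      also have "\<dots> \<le> card (A - B) + card (\<Union>(N ` B))" by (rule card_Un_le)
      also have "card (A - B) = card A - card B"
        using B fA by (meson card_Diff_subset finite_subset)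
      finally show "card B \<le> card (\<Union>(N ` B))"
        using card_mono[OF fA(1) B] by linarith
    qed (use fA in \<open>auto simp: N_def\<close>)
    then obtain m where m: "inj_on m A" "\<And>a. a \<in> A \<Longrightarrow> m a \<in> N a" by blast
    \<comment> \<open>An injection between finite sets of equal cardinality is onto, so averaging
      over the translate is averaging over the matched points.\<close>
    have "m ` A \<subseteq> \<tau> ` A" using m by (auto simp: N_def)
    then have mA: "m ` A = \<tau> ` A"
      using m \<tau> fA by (intro card_subset_eq) (auto simp: card_image)
    have "avg A (\<lambda>a. f (h \<otimes> a \<otimes> k)) = sum f (\<tau> ` A) / card A"
      using sum.reindex[OF \<tau>, of f] unfolding avg_def \<tau>_def[symmetric] by simp
    also have "\<dots> = avg A (\<lambda>a. f (m a))"
      using sum.reindex[OF m(1), of f] unfolding avg_def mA[symmetric] by simp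
    finally have "avg A (\<lambda>a. f (h \<otimes> a \<otimes> k)) = avg A (\<lambda>a. f (m a))" .
    moreover have "\<bar>avg A (\<lambda>a. f (m a)) - avg A f\<bar> \<le> e"
    proof (rule avg_diff_le[OF fA(1) \<open>A \<noteq> {}\<close>])
      fix a assume a: "a \<in> A"
      obtain y where y: "y \<in> carrier G" "near a y" "near (m a) y" using m(2)[OF a] by (auto simp: N_def)
      have c: "a \<in> carrier G" "m a \<in> carrier G"
        using a fA h k m(2)[OF a] by (auto simp: N_def \<tau>_def)
      have "\<bar>f (\<one> \<otimes> a \<otimes> \<one>) - f (\<one> \<otimes> y \<otimes> \<one>)\<bar> < e / 2"
        "\<bar>f (\<one> \<otimes> m a \<otimes> \<one>) - f (\<one> \<otimes> y \<otimes> \<one>)\<bar> < e / 2"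
        using y(2,3) f unfolding near_def by blast+
      then have "\<bar>f a - f y\<bar> < e / 2" "\<bar>f (m a) - f y\<bar> < e / 2"
        using c y by simp_all
      then show "\<bar>f (m a) - f a\<bar> \<le> e" by linarith
    qed
    ultimately show ?thesis by simp
  qed
  then show ?thesis using fA \<open>A \<noteq> {}\<close> unfolding good_def by blast
qed

text \<open>Both averages are compared with the double average of \<open>f (a \<otimes> b)\<close>.
  Read in one order it is an average of right translates of \<open>A\<close>, in the other of left
  translates of \<open>B\<close>.\<close>

lemma good_close:
  assumes A: "good A f e" and B: "good B f d"
  shows "\<bar>avg A f - avg B f\<bar> \<le> e + d"
proof -
  have "\<bar>avg B (\<lambda>b. avg A (\<lambda>a. f (a \<otimes> b))) - avg B (\<lambda>b. avg A f)\<bar> \<le> e"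
  proof (rule avg_diff_le)
    fix b assume "b \<in> B"
    then have "\<bar>avg A (\<lambda>a. f (\<one> \<otimes> a \<otimes> b)) - avg A f\<bar> \<le> e"
      using A B unfolding good_def by blast
    moreover have "avg A (\<lambda>a. f (\<one> \<otimes> a \<otimes> b)) = avg A (\<lambda>a. f (a \<otimes> b))"
      using A unfolding avg_def good_def by (intro arg_cong2[of _ _ _ _ "(/)"] sum.cong) auto
    ultimately show "\<bar>avg A (\<lambda>a. f (a \<otimes> b)) - avg A f\<bar> \<le> e" by simp
  qed (use B good_def in auto)
  moreover have "\<bar>avg A (\<lambda>a. avg B (\<lambda>b. f (a \<otimes> b))) - avg A (\<lambda>a. avg B f)\<bar> \<le> d"
  proof (rule avg_diff_le)
    fix a assume a: "a \<in> A"
    then have "\<bar>avg B (\<lambda>b. f (a \<otimes> b \<otimes> \<one>)) - avg B f\<bar> \<le> d"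
      using A B unfolding good_def by blast
    moreover have "avg B (\<lambda>b. f (a \<otimes> b \<otimes> \<one>)) = avg B (\<lambda>b. f (a \<otimes> b))"
      using A B a unfolding avg_def good_def
      by (intro arg_cong2[of _ _ _ _ "(/)"] sum.cong) (auto simp: subset_iff)
    ultimately show "\<bar>avg B (\<lambda>b. f (a \<otimes> b)) - avg B f\<bar> \<le> d" by simp
  qed (use A good_def in auto)
  ultimately show ?thesis
    using A B avg_swap[of A B "\<lambda>a b. f (a \<otimes> b)"] by (simp add: good_def avg_const)
qed

text \<open>By \<open>good_close\<close>, no lower end \<open>avg A f - e\<close> exceeds any upper
  end \<open>avg B f + d\<close>, so the supremum lies in all the intervals around almost invariant
  averages. For continuous \<open>f\<close> it plays the role of the normalized Haar integral,
  obtained without a measure and without choosing nets.\<close>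

definition haar :: "('g \<Rightarrow> real) \<Rightarrow> real" where
  "haar f = Sup {avg A f - e | A e. good A f e}"

lemma haar_approx:
  assumes "good A f e"
  shows "\<bar>haar f - avg A f\<bar> \<le> e"
proof -
  let ?S = "{avg A f - e | A e. good A f e}"
  have ub: "x \<le> avg A f + e" if "x \<in> ?S" for x
    using that good_close[OF _ assms] by (force simp: abs_le_iff)
  have "avg A f - e \<in> ?S" using assms by blast
  then have "avg A f - e \<le> haar f" "haar f \<le> avg A f + e"
    unfolding haar_def using ub by (auto intro!: cSup_upper cSup_least bdd_aboveI)
  then show ?thesis by linarith
qed

text \<open>Each rule for the mean is checked on a single net that serves all functions involved,
  where it is a rule for finite sums.\<close>

lemma haar_simultaneous_approx:
  assumes "finite F" "\<forall>f\<in>F. continuous_map TG euclideanreal f" "e > 0"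
  shows "\<exists>A. finite A \<and> A \<noteq> {} \<and> A \<subseteq> carrier G \<and> (\<forall>f\<in>F. good A f e \<and> \<bar>haar f - avg A f\<bar> \<le> e)"
proof -
  \<comment> \<open>The zero function makes \<open>A\<close> finite and nonempty also when
    \<open>F\<close> is empty.\<close>
  have "\<exists>A. \<forall>f\<in>insert (\<lambda>_. 0) F. good A f e"
    using assms by (intro exists_good) auto
  then obtain A where "\<forall>f\<in>insert (\<lambda>_. 0) F. good A f e" ..
  then show ?thesis using haar_approx by (intro exI[of _ A]) (auto simp: good_def)
qed

section \<open>Properties of the mean\<close>

lemma haar_mono:
  assumes "continuous_map TG euclideanreal f" "continuous_map TG euclideanreal k"
    and "\<And>g. g \<in> carrier G \<Longrightarrow> f g \<le> k g"
  shows "haar f \<le> haar k"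
proof (rule field_le_epsilon)
  fix e :: real assume "e > 0"
  then obtain A where A: "A \<subseteq> carrier G" "\<bar>haar f - avg A f\<bar> \<le> e/2" "\<bar>haar k - avg A k\<bar> \<le> e/2"
    using haar_simultaneous_approx[of "{f, k}" "e/2"] assms by auto
  moreover have "avg A f \<le> avg A k" using A assms by (intro avg_mono) auto
  ultimately show "haar f \<le> haar k + e" by linarith
qed

lemma haar_cong:
  assumes "continuous_map TG euclideanreal f" and "\<And>g. g \<in> carrier G \<Longrightarrow> f g = k g"
  shows "haar f = haar k"
proof -
  have "continuous_map TG euclideanreal k"
    using assms continuous_map_eq topspace_TG by metis
  then show ?thesis using assms haar_mono[of f k] haar_mono[of k f] by force
qed

lemma haar_add:
  assumes "continuous_map TG euclideanreal f" "continuous_map TG euclideanreal k"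
  shows "haar (\<lambda>g. f g + k g) = haar f + haar k"
proof -
  have c: "continuous_map TG euclideanreal (\<lambda>g. f g + k g)" using assms by (rule continuous_map_add)
  have "\<bar>haar (\<lambda>g. f g + k g) - (haar f + haar k)\<bar> \<le> e" if "e > 0" for e
  proof -
    obtain A where A: "\<bar>haar f - avg A f\<bar> \<le> e/3" "\<bar>haar k - avg A k\<bar> \<le> e/3"
      "\<bar>haar (\<lambda>g. f g + k g) - avg A (\<lambda>g. f g + k g)\<bar> \<le> e/3"
      using haar_simultaneous_approx[of "{f, k, \<lambda>g. f g + k g}" "e/3"] assms c \<open>e > 0\<close> by auto
    then show ?thesis unfolding avg_add by argo
  qed
  then show ?thesis by (rule eq_if_arbitrarily_close)
qed

lemma haar_cmult:
  assumes "continuous_map TG euclideanreal f"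
  shows "haar (\<lambda>g. c * f g) = c * haar f"
proof -
  have c: "continuous_map TG euclideanreal (\<lambda>g. c * f g)"
    using assms by (intro continuous_map_real_mult) auto
  have "\<bar>haar (\<lambda>g. c * f g) - c * haar f\<bar> \<le> e" if "e > 0" for e
  proof -
    \<comment> \<open>The errors are \<open>\<bar>c\<bar> * d\<close> from \<open>f\<close> and
      \<open>d\<close> from its multiple; the added 1 also covers \<open>c = 0\<close>.\<close>
    define d where "d = e / (1 + \<bar>c\<bar>)"
    have pos: "1 + \<bar>c\<bar> > 0" by linarith
    then have "d > 0" using that by (simp add: d_def)
    then obtain A where A: "\<bar>haar f - avg A f\<bar> \<le> d"
      "\<bar>haar (\<lambda>g. c * f g) - avg A (\<lambda>g. c * f g)\<bar> \<le> d"
      using haar_simultaneous_approx[of "{f, \<lambda>g. c * f g}" d] assms c by auto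
    have "\<bar>c * haar f - c * avg A f\<bar> \<le> \<bar>c\<bar> * d"
      using A(1) by (simp add: right_diff_distrib[symmetric] abs_mult mult_left_mono)
    then have "\<bar>haar (\<lambda>g. c * f g) - c * haar f\<bar> \<le> (1 + \<bar>c\<bar>) * d"
      using A(2) unfolding avg_cmult by (simp add: algebra_simps)
    then show ?thesis using pos by (simp add: d_def)
  qed
  then show ?thesis by (rule eq_if_arbitrarily_close)
qed

lemma haar_const: "haar (\<lambda>g. c) = c"
proof -
  have "\<bar>haar (\<lambda>g. c) - c\<bar> \<le> e" if "e > 0" for e
  proof -
    define f :: "'g \<Rightarrow> real" where "f = (\<lambda>g. c)"
    have "finite {f}" "\<forall>k\<in>{f}. continuous_map TG euclideanreal k" by (simp_all add: f_def)
    from haar_simultaneous_approx[OF this that] obtain A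
      where "finite A" "A \<noteq> {}" "\<bar>haar f - avg A f\<bar> \<le> e" by auto
    then show ?thesis by (simp add: avg_const f_def)
  qed
  then show ?thesis by (rule eq_if_arbitrarily_close)
qed

text \<open>Right translation is the one that a left action produces: acting with \<open>g\<close>
  after \<open>h\<close> is acting with \<open>g \<otimes> h\<close>.\<close>

lemma haar_right_translate:
  assumes f: "continuous_map TG euclideanreal f" and h: "h \<in> carrier G"
  shows "haar (\<lambda>g. f (g \<otimes> h)) = haar f"
proof -
  have "continuous_map TG TG (\<lambda>g. g \<otimes> h)"
    using h by (intro continuous_map_mult) (auto simp: topspace_TG)
  from continuous_map_compose[OF this f]
  have c: "continuous_map TG euclideanreal (\<lambda>g. f (g \<otimes> h))" by (simp add: o_def)
  have "\<bar>haar (\<lambda>g. f (g \<otimes> h)) - haar f\<bar> \<le> e" if "e > 0" for e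
  proof -
    obtain A where A: "good A f (e/3)" "A \<subseteq> carrier G" "\<bar>haar f - avg A f\<bar> \<le> e/3"
      "\<bar>haar (\<lambda>g. f (g \<otimes> h)) - avg A (\<lambda>g. f (g \<otimes> h))\<bar> \<le> e/3"
      using haar_simultaneous_approx[of "{f, \<lambda>g. f (g \<otimes> h)}" "e/3"] f c \<open>e > 0\<close> by auto
    have "\<bar>avg A (\<lambda>a. f (\<one> \<otimes> a \<otimes> h)) - avg A f\<bar> \<le> e/3"
      using A(1) h unfolding good_def by blast
    moreover have "avg A (\<lambda>a. f (\<one> \<otimes> a \<otimes> h)) = avg A (\<lambda>a. f (a \<otimes> h))"
      using A(2) unfolding avg_def by (intro arg_cong2[of _ _ _ _ "(/)"] sum.cong) auto
    ultimately show ?thesis using A by linarith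
  qed
  then show ?thesis by (rule eq_if_arbitrarily_close)
qed

lemma haar_abs_diff_le:
  assumes "continuous_map TG euclideanreal f" "continuous_map TG euclideanreal k"
    and "\<And>g. g \<in> carrier G \<Longrightarrow> \<bar>f g - k g\<bar> \<le> e"
  shows "\<bar>haar f - haar k\<bar> \<le> e"
proof -
  have "haar f \<le> haar (\<lambda>g. k g + e)" "haar k \<le> haar (\<lambda>g. f g + e)"
    using assms(3) by (intro haar_mono continuous_map_add assms; force simp: abs_le_iff)+
  then show ?thesis using assms by (simp add: haar_add haar_const abs_le_iff)
qed

text \<open>Compactness of the group turns joint continuity into closeness uniform in the group
  variable, and the mean cannot enlarge a uniform bound.\<close>

lemma continuous_map_haar:
  assumes F: "continuous_map (prod_topology TG Z) euclideanreal F"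
  shows "continuous_map Z euclideanreal (\<lambda>z. haar (\<lambda>g. F (g, z)))"
  unfolding continuous_map_real_iff
proof (intro ballI allI impI)
  fix z and e :: real assume z: "z \<in> topspace Z" and "e > 0"
  have c: "continuous_map TG euclideanreal (\<lambda>g. F (g, w))" if "w \<in> topspace Z" for w
    using continuous_map_compose[OF _ F, of TG "\<lambda>g. (g, w)"] that
    by (simp add: o_def continuous_map_pairedI)
  obtain N where N: "openin Z N" "z \<in> N"
    "\<And>g w. g \<in> topspace TG \<Longrightarrow> w \<in> N \<Longrightarrow> \<bar>F (g, w) - F (g, z)\<bar> < e / 2"
    using continuous_map_compact_uniform[OF compact F z, of "e/2"] \<open>e > 0\<close> by auto
  have "\<bar>haar (\<lambda>g. F (g, w)) - haar (\<lambda>g. F (g, z))\<bar> \<le> e / 2" if "w \<in> N" for w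
    using N that z openin_subset[OF N(1)]
    by (intro haar_abs_diff_le c) (auto simp: topspace_TG less_imp_le)
  then show "\<exists>U. openin Z U \<and> z \<in> U \<and> (\<forall>w\<in>U. \<bar>haar (\<lambda>g. F (g, w)) - haar (\<lambda>g. F (g, z))\<bar> < e)"
    using N \<open>e > 0\<close> by (intro exI[of _ N]) force
qed

end

section \<open>Stratifiable spaces\<close>

lemma not_in_closure_ofI:
  assumes "openin Y N" "y \<in> N" "N \<inter> A = {}"
  shows "y \<notin> Y closure_of A"
  unfolding in_closure_of using assms by blast

section \<open>Monotone strata and normality\<close>

locale stratification =
  fixes Y :: "'a topology" and S :: "'a set \<Rightarrow> nat \<Rightarrow> 'a set"
  assumes Hausdorff: "Hausdorff_space Y"
    and openin_S: "openin Y U \<Longrightarrow> openin Y (S U n)"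
    and closure_S: "openin Y U \<Longrightarrow> Y closure_of S U n \<subseteq> U"
    and Union_S: "openin Y U \<Longrightarrow> (\<Union>n. S U n) = U"
    and S_mono: "openin Y U \<Longrightarrow> openin Y V \<Longrightarrow> U \<subseteq> V \<Longrightarrow> m \<le> n \<Longrightarrow> S U m \<subseteq> S V n"

lemma stratifiable_imp_stratification:
  assumes "stratifiable_space Y"
  obtains S where "stratification Y S"
proof -
  have Y: "Hausdorff_space Y" using assms by (simp add: stratifiable_space_def)
  obtain S :: "'a set \<Rightarrow> nat \<Rightarrow> 'a set" where
    "(\<forall>U n. openin Y U \<longrightarrow> openin Y (S U n) \<and> Y closure_of (S U n) \<subseteq> U) \<and>
     (\<forall>U. openin Y U \<longrightarrow> (\<Union>n. S U n) = U) \<and>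
     (\<forall>U V n. openin Y U \<and> openin Y V \<and> U \<subseteq> V \<longrightarrow> S U n \<subseteq> S V n)"
    using assms unfolding stratifiable_space_def by (elim conjE exE) (rule that, intro conjI)
  then have S: "openin Y U \<Longrightarrow> openin Y (S U n) \<and> Y closure_of (S U n) \<subseteq> U"
    "openin Y U \<Longrightarrow> (\<Union>n. S U n) = U"
    "openin Y U \<Longrightarrow> openin Y V \<Longrightarrow> U \<subseteq> V \<Longrightarrow> S U n \<subseteq> S V n" for U V n
    by simp_all
  \<comment> \<open>Finite unions of the given strata make the sequence increasing as well; the
    closure of a finite union is still inside \<open>U\<close>.\<close>
  have "stratification Y (\<lambda>U n. \<Union>k\<le>n. S U k)"
  proof
    show "Hausdorff_space Y" by fact
    fix U n assume U: "openin Y U"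
    show "openin Y (\<Union>k\<le>n. S U k)" using S(1)[OF U] by auto
    show "Y closure_of (\<Union>k\<le>n. S U k) \<subseteq> U"
      using S(1)[OF U] by (subst closure_of_Union) auto
    show "(\<Union>n. \<Union>k\<le>n. S U k) = U" using S(2)[OF U] by fastforce
  next
    fix U V and m n :: nat assume "openin Y U" "openin Y V" "U \<subseteq> V" "m \<le> n"
    then have "S U k \<subseteq> S V k" "k \<le> m \<Longrightarrow> k \<le> n" for k using S(3) by auto
    then show "(\<Union>k\<le>m. S U k) \<subseteq> (\<Union>k\<le>n. S V k)" by fast
  qed
  then show thesis by (rule that)
qed

context stratification
begin

lemma S_subset: "openin Y U \<Longrightarrow> S U n \<subseteq> U"
  using Union_S by blast

lemma S_subset_closure: "openin Y U \<Longrightarrow> S U n \<subseteq> Y closure_of S U n"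
  by (simp add: closure_of_subset openin_S openin_subset)

lemma openin_S_diff: "openin Y U \<Longrightarrow> openin Y (S U n - Y closure_of A)"
  by (simp add: openin_S openin_diff)

lemma S_cases:
  assumes "openin Y U" "y \<in> U"
  obtains n where "y \<in> S U n"
  using assms Union_S by blast

lemma normal: "normal_space Y"
  unfolding normal_space_def
proof (intro allI impI, elim conjE)
  fix A B assume A: "closedin Y A" and B: "closedin Y B" and "disjnt A B"
  define P where "P = S (topspace Y - B)"
  define Q where "Q = S (topspace Y - A)"
  have oA: "openin Y (topspace Y - A)" and oB: "openin Y (topspace Y - B)" using A B by auto
  have P: "openin Y (P n)" "Y closure_of P n \<subseteq> topspace Y - B" "P n \<subseteq> Y closure_of P n"
    "m \<le> n \<Longrightarrow> P m \<subseteq> P n" for m n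
    unfolding P_def using openin_S[OF oB] closure_S[OF oB] S_subset_closure[OF oB] S_mono[OF oB oB] by auto
  have Q: "openin Y (Q n)" "Y closure_of Q n \<subseteq> topspace Y - A" "Q n \<subseteq> Y closure_of Q n"
    "m \<le> n \<Longrightarrow> Q m \<subseteq> Q n" for m n
    unfolding Q_def using openin_S[OF oA] closure_S[OF oA] S_subset_closure[OF oA] S_mono[OF oA oA] by auto
  \<comment> \<open>Strata of equal index are cut off each other. Points of \<open>A\<close> survive
    because the closures of the \<open>Q n\<close> miss \<open>A\<close>. A common point of a piece
    of \<open>U\<close> and a piece of \<open>V\<close> would, as the strata increase, lie in the
    closure that the piece of larger index removes.\<close>
  define U where "U = (\<Union>n. P n - Y closure_of Q n)"
  define V where "V = (\<Union>n. Q n - Y closure_of P n)"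
  have "openin Y U" "openin Y V"
    unfolding U_def V_def using P Q by (auto intro!: openin_Union openin_diff)
  moreover have "A \<subseteq> U"
  proof
    fix y assume y: "y \<in> A"
    then have "y \<in> topspace Y - B"
      using closedin_subset[OF A] \<open>disjnt A B\<close> by (auto simp: disjnt_def)
    then obtain n where "y \<in> P n" unfolding P_def using S_cases[OF oB] by blast
    then show "y \<in> U" using y Q(2)[of n] unfolding U_def by blast
  qed
  moreover have "B \<subseteq> V"
  proof
    fix y assume y: "y \<in> B"
    then have "y \<in> topspace Y - A"
      using closedin_subset[OF B] \<open>disjnt A B\<close> by (auto simp: disjnt_def)
    then obtain n where "y \<in> Q n" unfolding Q_def using S_cases[OF oA] by blast
    then show "y \<in> V" using y P(2)[of n] unfolding V_def by blast
  qed
  moreover have "disjnt U V"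
  proof -
    have False if "y \<in> P m" "y \<notin> Y closure_of Q m" "y \<in> Q n" "y \<notin> Y closure_of P n" for y m n
      using that P(3,4) Q(3,4) by (meson le_cases subsetD)
    then show ?thesis unfolding U_def V_def disjnt_def by blast
  qed
  ultimately show "\<exists>U V. openin Y U \<and> openin Y V \<and> A \<subseteq> U \<and> B \<subseteq> V \<and> disjnt U V" by blast
qed

text \<open>Michael's cushioned refinement with a fixed index set. Closures are considered only
  inside the union of the \<open>U i\<close>, because the family may cover just an open
  subspace.\<close>

definition cushioned :: "('i \<Rightarrow> 'a set) \<Rightarrow> ('i \<Rightarrow> 'a set) \<Rightarrow> bool" where
  "cushioned U V \<longleftrightarrow> (\<forall>i. openin Y (V i) \<and> V i \<subseteq> U i) \<and> (\<Union>i. V i) = (\<Union>i. U i) \<and>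
     (\<forall>J. Y closure_of (\<Union>i\<in>J. V i) \<inter> (\<Union>i. U i) \<subseteq> (\<Union>i\<in>J. U i))"

lemma exists_cushioned:
  fixes U :: "'i \<Rightarrow> 'a set"
  assumes U: "\<And>i. openin Y (U i)"
  shows "\<exists>V. cushioned U V"
proof -
  \<comment> \<open>\<open>R n\<close> is what the strata of index below \<open>n\<close> cover.
    Stage \<open>n\<close> of \<open>V i\<close> thus keeps the points first reached at stage
    \<open>n\<close>, while near any covered point all sufficiently late stages are removed.\<close>
  define R where "R n = (\<Union>i. \<Union>k<n. S (U i) k)" for n
  have oR: "openin Y (R n)" for n unfolding R_def by (auto intro!: openin_Union openin_S U)
  have R_mono: "R m \<subseteq> R n" if "m \<le> n" for m n using that unfolding R_def by fastforce
  define V where "V i = (\<Union>n. S (U i) n - Y closure_of S (R n) n)" for i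
  have oV: "openin Y (V i)" and VU: "V i \<subseteq> U i" for i
    unfolding V_def using U S_subset[OF U] by (auto intro!: openin_Union openin_S_diff)
  have cover: "y \<in> (\<Union>i. V i)" if y: "y \<in> U i" for y i
  proof -
    define n where "n = (LEAST n. \<exists>i. y \<in> S (U i) n)"
    have "\<exists>n i. y \<in> S (U i) n" using S_cases[OF U y] by blast
    then have "\<exists>i. y \<in> S (U i) n" unfolding n_def by (rule LeastI_ex)
    then obtain i where i: "y \<in> S (U i) n" by blast
    have "y \<notin> R n" unfolding R_def n_def using not_less_Least by fastforce
    then have "y \<notin> Y closure_of S (R n) n" using closure_S[OF oR] by blast
    then show ?thesis using i unfolding V_def by blast
  qed
  have closure: "y \<notin> Y closure_of (\<Union>i\<in>J. V i)" if y: "y \<in> U i" "y \<notin> (\<Union>i\<in>J. U i)" for y i J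
  proof -
    have oJ: "openin Y (\<Union>i\<in>J. U i)" using U by auto
    obtain k where "y \<in> S (U i) k" using S_cases[OF U y(1)] by blast
    then have "y \<in> R (Suc k)" unfolding R_def by blast
    then obtain l where l: "y \<in> S (R (Suc k)) l" using S_cases[OF oR] by blast
    define m where "m = max (Suc k) l"
    have ym: "y \<in> S (R m) m"
      using l S_mono[OF oR oR, of "Suc k" m l m] R_mono[of "Suc k" m] by (auto simp: m_def)
    show ?thesis
    proof (rule not_in_closure_ofI)
      show "openin Y (S (R m) m - Y closure_of S (\<Union>i\<in>J. U i) m)" by (rule openin_S_diff[OF oR])
      show "y \<in> S (R m) m - Y closure_of S (\<Union>i\<in>J. U i) m"
        using ym y closure_S[OF oJ] by blast
      \<comment> \<open>Stages from \<open>m\<close> on are removed because \<open>S (R m) m\<close>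
        is contained in \<open>S (R n) n\<close>. Earlier stages of members of \<open>J\<close> lie
        in stratum \<open>m\<close> of their union, whose closure the neighbourhood
        excludes.\<close>
      have False if z: "z \<in> S (R m) m" "z \<notin> Y closure_of S (\<Union>i\<in>J. U i) m" "j \<in> J"
        "z \<in> S (U j) n" "z \<notin> Y closure_of S (R n) n" for z j n
      proof (cases "m \<le> n")
        case True
        then have "z \<in> S (R n) n" using z(1) S_mono[OF oR oR R_mono] by blast
        then show False using z(5) S_subset_closure[OF oR] by blast
      next
        case False
        have "U j \<subseteq> (\<Union>i\<in>J. U i)" using z(3) by blast
        then have "z \<in> S (\<Union>i\<in>J. U i) m" using False z(4) S_mono[OF U oJ, of j n m] by auto
        then show False using z(2) S_subset_closure[OF oJ] by blast
      qed
      then show "(S (R m) m - Y closure_of S (\<Union>i\<in>J. U i) m) \<inter> (\<Union>i\<in>J. V i) = {}"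
        unfolding V_def by blast
    qed
  qed
  have "(\<Union>i. V i) = (\<Union>i. U i)" using VU cover by blast
  moreover have "Y closure_of (\<Union>i\<in>J. V i) \<inter> (\<Union>i. U i) \<subseteq> (\<Union>i\<in>J. U i)" for J
    using closure[of _ _ J] by blast
  ultimately have "cushioned U V" using oV VU by (simp add: cushioned_def)
  then show ?thesis by (intro exI[of _ V])
qed

text \<open>
  Michael's argument: cushioned refinements are taken repeatedly, each time after removing from
  the \<open>i\<close>-th set what the earlier sets of the previous refinement have covered. The least index
  \<open>i\<close> with \<open>y \<in> V k i\<close> for some \<open>k\<close> is then the only one active near \<open>y\<close> at stage \<open>k + 1\<close>.
\<close>

lemma exists_sigma_disjoint_refinement:
  fixes U :: "'i \<Rightarrow> 'a set"
  assumes U: "\<And>i. openin Y (U i)"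
  obtains D :: "nat \<Rightarrow> 'i \<Rightarrow> 'a set" where "\<And>n i. openin Y (D n i)" "\<And>n i. D n i \<subseteq> U i"
    "\<And>n i j. i \<noteq> j \<Longrightarrow> D n i \<inter> D n j = {}" "(\<Union>n. \<Union>i. D n i) = (\<Union>i. U i)"
proof -
  obtain r :: "'i rel" where r: "Well_order r" "Field r = UNIV"
    using well_ordering[where 'a = 'i] by (elim exE conjE)
  define lt where "lt i j \<longleftrightarrow> (i, j) \<in> r \<and> i \<noteq> j" for i j
  have total: "lt i j \<or> i = j \<or> lt j i" for i j
  proof -
    have "total r" using r by (simp add: well_order_on_def linear_order_on_def)
    then show ?thesis unfolding lt_def total_on_def by blast
  qed
  have min: "\<exists>i\<in>A. \<forall>j\<in>A. \<not> lt j i" if A: "A \<noteq> {}" for A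
  proof -
    have "wf (r - Id)" using r by (simp add: well_order_on_def)
    moreover obtain a where "a \<in> A" using A by blast
    ultimately obtain i where "i \<in> A" "\<And>j. (j, i) \<in> r - Id \<Longrightarrow> j \<notin> A"
      by (rule wfE_min) blast
    then show ?thesis unfolding lt_def by blast
  qed
  define shrink where "shrink V i = U i - Y closure_of (\<Union>j\<in>{j. lt j i}. V j)"
    for V :: "'i \<Rightarrow> 'a set" and i
  \<comment> \<open>\<open>F n\<close> is the family entering stage \<open>n\<close> and
    \<open>V n\<close> its chosen cushioned refinement; the recursion repeats the choice that
    \<open>V\<close> makes.\<close>
  define F where "F n = rec_nat U (\<lambda>_ F. shrink (SOME V. cushioned F V)) n" for n
  define V where "V n = (SOME V. cushioned (F n) V)" for n
  have F0: "F 0 = U" and FSuc: "F (Suc n) = shrink (V n)" for n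
    by (simp_all add: F_def V_def)
  have oF: "openin Y (F n i)" for n i
    using U by (cases n) (auto simp: F0 FSuc shrink_def)
  have FU: "F n i \<subseteq> U i" for n i
    by (cases n) (auto simp: F0 FSuc shrink_def)
  have V: "cushioned (F n) (V n)" for n
    unfolding V_def using exists_cushioned[OF oF] by (rule someI_ex)
  have F: "(\<Union>i. F n i) = (\<Union>i. U i)" for n
  proof (induction n)
    case (Suc n)
    have "\<exists>i. y \<in> F (Suc n) i" if y: "y \<in> (\<Union>i. U i)" for y
    proof -
      \<comment> \<open>For the least \<open>i\<close> with \<open>y \<in> U i\<close>, the smaller
        members of \<open>F n\<close> miss \<open>y\<close>, so cushioning keeps \<open>y\<close>
        out of the closure that is removed from \<open>U i\<close>.\<close>
      obtain i where i: "y \<in> U i" "\<And>j. y \<in> U j \<Longrightarrow> \<not> lt j i"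
        using min[of "{i. y \<in> U i}"] y by blast
      have "Y closure_of (\<Union>j\<in>{j. lt j i}. V n j) \<inter> (\<Union>i. U i) \<subseteq> (\<Union>j\<in>{j. lt j i}. F n j)"
        using V[of n] unfolding cushioned_def Suc by simp
      moreover have "y \<notin> (\<Union>j\<in>{j. lt j i}. F n j)" using i FU by blast
      ultimately show ?thesis using i y unfolding FSuc shrink_def by blast
    qed
    then show ?case using FU[of "Suc n"] by blast
  qed (simp add: F0)
  have oV: "openin Y (V n i)" and VF: "V n i \<subseteq> F n i" for n i
    using V[of n] unfolding cushioned_def by simp_all
  have VW: "(\<Union>i. V n i) = (\<Union>i. U i)" for n
    using V[of n] F[of n] unfolding cushioned_def by simp
  have later: "V (Suc n) i \<inter> Y closure_of (\<Union>j\<in>{j. lt j i}. V n j) = {}" for n i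
    using VF[of "Suc n" i] unfolding FSuc shrink_def by blast
  have sub_closure: "V n j \<subseteq> Y closure_of (\<Union>j\<in>A. V n j)" if "j \<in> A" for n j A
  proof -
    have "(\<Union>j\<in>A. V n j) \<subseteq> topspace Y" using oV openin_subset by blast
    from closure_of_subset[OF this] show ?thesis using that by blast
  qed
  define D where "D n i = V n i - Y closure_of (\<Union>j\<in>-{i}. V n j)" for n i
  have oD: "openin Y (D n i)" for n i
    unfolding D_def using oV by (intro openin_diff) auto
  have DU: "D n i \<subseteq> U i" for n i unfolding D_def using VF FU by blast
  have disj: "D n i \<inter> D n j = {}" if "i \<noteq> j" for n i j
    using that sub_closure[of j "-{i}" n] unfolding D_def by blast
  have cover: "\<exists>n i. y \<in> D n i" if y: "y \<in> (\<Union>i. U i)" for y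
  proof -
    have ex: "\<exists>i. y \<in> V n i" for n using y VW[of n] by blast
    then obtain i where "\<exists>n. y \<in> V n i" and min_i: "\<And>j n. y \<in> V n j \<Longrightarrow> \<not> lt j i"
      using min[of "{i. \<exists>n. y \<in> V n i}"] by blast
    then obtain k where k: "y \<in> V k i" by blast
    \<comment> \<open>At the next stage some \<open>j\<close> has \<open>y\<close>: a
      \<open>j\<close> above \<open>i\<close> is excluded by the removal, a \<open>j\<close> below
      \<open>i\<close> by the choice of \<open>i\<close>.\<close>
    have step: "y \<in> V (Suc n) i" if n: "y \<in> V n i" for n
    proof -
      obtain j where j: "y \<in> V (Suc n) j" using ex by blast
      have "\<not> lt i j"
        using j n later[of n j] sub_closure[of i "{l. lt l j}" n] by blast
      then have "j = i" using total min_i[OF j] by blast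
      then show ?thesis using j by simp
    qed
    \<comment> \<open>Stage \<open>k\<close> keeps the indices above \<open>i\<close> away from
      \<open>y\<close> at stage \<open>k + 1\<close>, and membership at stage \<open>k + 2\<close>
      shows that the sets of index below \<open>i\<close> at stage \<open>k + 1\<close> do not
      accumulate at \<open>y\<close>. So \<open>D\<close> is taken at the middle stage.\<close>
    have k1: "y \<in> V (Suc k) i" and k2: "y \<in> V (Suc (Suc k)) i" using step k by blast+
    have "V k i \<inter> V (Suc k) j = {}" if "lt i j" for j
      using later[of k j] sub_closure[of i "{l. lt l j}" k] that by blast
    then have "y \<notin> Y closure_of (\<Union>j\<in>{j. lt i j}. V (Suc k) j)"
      by (intro not_in_closure_ofI[OF oV k]) blast
    moreover have "y \<notin> Y closure_of (\<Union>j\<in>{j. lt j i}. V (Suc k) j)"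
      using k2 later[of "Suc k" i] by blast
    moreover have "(\<Union>j\<in>-{i}. V (Suc k) j) =
        (\<Union>j\<in>{j. lt i j}. V (Suc k) j) \<union> (\<Union>j\<in>{j. lt j i}. V (Suc k) j)"
    proof -
      have "- {i} = {j. lt i j} \<union> {j. lt j i}" using total by (auto simp: lt_def)
      then show ?thesis by auto
    qed
    ultimately have "y \<in> D (Suc k) i" using k1 unfolding D_def by simp
    then show ?thesis by blast
  qed
  have "(\<Union>n. \<Union>i. D n i) = (\<Union>i. U i)"
  proof (intro equalityI subsetI)
    fix y assume "y \<in> (\<Union>n. \<Union>i. D n i)"
    then obtain n i where "y \<in> D n i" by auto
    then show "y \<in> (\<Union>i. U i)" using DU[of n i] by auto
  qed (use cover in auto)
  from that[OF oD DU disj this] show thesis .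
qed

text \<open>Shaped for stick-breaking: beyond a function equal to 1 nothing is used, so only
  finitely many labels have to be locally constant. Disjointness within each family
  \<open>D n\<close> makes the labels unique.\<close>

lemma exists_locally_constant_partition:
  fixes U :: "'i \<Rightarrow> 'a set"
  assumes U: "\<And>i. openin Y (U i)"
  obtains u :: "nat \<Rightarrow> 'a \<Rightarrow> real" and c :: "nat \<Rightarrow> 'a \<Rightarrow> 'i"
  where "\<And>j. continuous_map Y euclideanreal (u j)" "\<And>j y. y \<in> topspace Y \<Longrightarrow> u j y \<in> {0..1}"
    "\<And>j y. y \<in> topspace Y \<Longrightarrow> u j y > 0 \<Longrightarrow> y \<in> U (c j y)"
    "\<And>y. y \<in> (\<Union>i. U i) \<Longrightarrow> \<exists>N k. openin Y N \<and> y \<in> N \<and>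
       (\<forall>z\<in>N. u k z = 1 \<and> (\<forall>j\<le>k. u j z > 0 \<longrightarrow> c j z = c j y))"
proof (rule exists_sigma_disjoint_refinement[where U = U, OF U])
  fix D :: "nat \<Rightarrow> 'i \<Rightarrow> 'a set"
  assume D: "\<And>n i. openin Y (D n i)" "\<And>n i. D n i \<subseteq> U i"
    "\<And>n i j. i \<noteq> j \<Longrightarrow> D n i \<inter> D n j = {}" "(\<Union>n. \<Union>i. D n i) = (\<Union>i. U i)"
  define E where "E n = (\<Union>i. D n i)" for n
  have oE: "openin Y (E n)" for n unfolding E_def using D(1) by auto
  \<comment> \<open>Every point of \<open>E n\<close> lies in some open stratum of it, so one of
    these functions is 1 around that point.\<close>
  have "\<forall>n m. \<exists>v. continuous_map Y euclideanreal v \<and> v ` topspace Y \<subseteq> {0..1} \<and>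
      (\<forall>y\<in>topspace Y - E n. v y = 0) \<and> (\<forall>y\<in>S (E n) m. v y = 1)"
  proof (intro allI)
    fix n m
    have "closedin Y (topspace Y - E n)" "closedin Y (Y closure_of S (E n) m)" using oE by auto
    moreover have "disjnt (topspace Y - E n) (Y closure_of S (E n) m)"
      using closure_S[OF oE] by (auto simp: disjnt_def)
    ultimately obtain v where v: "continuous_map Y (top_of_set {0..1::real}) v"
      "v ` (topspace Y - E n) \<subseteq> {0}" "v ` (Y closure_of S (E n) m) \<subseteq> {1}"
      using Urysohn_lemma[OF normal, of "topspace Y - E n" "Y closure_of S (E n) m" 0 "1::real"]
      by auto
    then show "\<exists>v. continuous_map Y euclideanreal v \<and> v ` topspace Y \<subseteq> {0..1} \<and>
      (\<forall>y\<in>topspace Y - E n. v y = 0) \<and> (\<forall>y\<in>S (E n) m. v y = 1)"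
      using S_subset_closure[OF oE, of n m]
      by (intro exI[of _ v]) (auto simp: continuous_map_in_subtopology image_subset_iff subset_iff)
  qed
  then obtain v :: "nat \<Rightarrow> nat \<Rightarrow> 'a \<Rightarrow> real" where
    "\<forall>n m. continuous_map Y euclideanreal (v n m) \<and> v n m ` topspace Y \<subseteq> {0..1} \<and>
      (\<forall>y\<in>topspace Y - E n. v n m y = 0) \<and> (\<forall>y\<in>S (E n) m. v n m y = 1)"
    by metis
  then have v: "continuous_map Y euclideanreal (v n m)" "v n m ` topspace Y \<subseteq> {0..1}"
    "y \<in> topspace Y - E n \<Longrightarrow> v n m y = 0" "y \<in> S (E n) m \<Longrightarrow> v n m y = 1" for n m y
    by simp_all
  define fst' where "fst' j = fst (prod_decode j)" for j
  define snd' where "snd' j = snd (prod_decode j)" for j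
  define w where "w j = v (fst' j) (snd' j)" for j
  \<comment> \<open>Cutting off at 1/2 makes \<open>u j\<close> vanish in a neighbourhood of every
    point off \<open>E (fst' j)\<close>; otherwise labels could vary near the boundary where
    \<open>u j\<close> is still positive.\<close>
  define u where "u j y = max 0 (2 * w j y - 1)" for j y
  define c where "c j y = (SOME i. y \<in> D (fst' j) i)" for j y
  have w: "continuous_map Y euclideanreal (w j)" "y \<in> topspace Y \<Longrightarrow> w j y \<in> {0..1}"
    "y \<in> topspace Y - E (fst' j) \<Longrightarrow> w j y = 0" for j y
    using v(1,3) v(2)[of "fst' j" "snd' j"] unfolding w_def by blast+
  have c: "c j y = i" if "y \<in> D (fst' j) i" for j y i
    unfolding c_def using that D(3) by (intro some_equality) blast+
  have local: "\<exists>N. openin Y N \<and> y \<in> N \<and> (\<forall>z\<in>N. u j z > 0 \<longrightarrow> c j z = c j y)"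
    if y: "y \<in> topspace Y" for j y
  proof (cases "y \<in> E (fst' j)")
    case True
    then obtain i where "y \<in> D (fst' j) i" unfolding E_def by blast
    then show ?thesis using D(1) c by (intro exI[of _ "D (fst' j) i"]) auto
  next
    case False
    have "openin Y {z \<in> topspace Y. w j z \<in> {..<1/2}}"
      using w(1) by (rule openin_continuous_map_preimage) auto
    then show ?thesis using w(3) y False
      by (intro exI[of _ "{z \<in> topspace Y. w j z \<in> {..<1/2}}"]) (auto simp: u_def)
  qed
  show thesis
  proof (rule that[of u c])
    show "continuous_map Y euclideanreal (u j)" for j
      unfolding u_def using w(1)
      by (intro continuous_map_real_max continuous_map_diff continuous_map_real_mult) auto
    show "u j y \<in> {0..1}" if "y \<in> topspace Y" for j y
      using w(2)[OF that, of j] by (auto simp: u_def)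
    show "y \<in> U (c j y)" if y: "y \<in> topspace Y" and pos: "u j y > 0" for j y
    proof -
      have "w j y \<noteq> 0" using pos by (auto simp: u_def)
      then obtain i where "y \<in> D (fst' j) i" using w(3)[of y j] y unfolding E_def by blast
      then show ?thesis using c D(2) by blast
    qed
    fix y assume "y \<in> (\<Union>i. U i)"
    then obtain n where n: "y \<in> E n" using D(4) unfolding E_def by blast
    then obtain m where m: "y \<in> S (E n) m" using S_cases[OF oE] by blast
    have y: "y \<in> topspace Y" using n oE openin_subset by blast
    define k where "k = prod_encode (n, m)"
    have "u k z = 1" if "z \<in> S (E n) m" for z
      using v(4)[OF that] by (simp add: u_def w_def k_def fst'_def snd'_def)
    moreover obtain N where N: "\<And>j. openin Y (N j) \<and> y \<in> N j \<and> (\<forall>z\<in>N j. u j z > 0 \<longrightarrow> c j z = c j y)"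
      using local[OF y] by metis
    moreover have "openin Y (S (E n) m \<inter> (topspace Y \<inter> (\<Inter>j\<in>{..k}. N j)))"
      using N openin_S[OF oE] by (intro openin_Int openin_Inter_finite) auto
    ultimately show "\<exists>N k. openin Y N \<and> y \<in> N \<and>
        (\<forall>z\<in>N. u k z = 1 \<and> (\<forall>j\<le>k. u j z > 0 \<longrightarrow> c j z = c j y))"
      using m y by (intro exI[of _ "S (E n) m \<inter> (topspace Y \<inter> (\<Inter>j\<in>{..k}. N j))"] exI[of _ k]) auto
  qed
qed

section \<open>Borges's neighbourhoods and the Dugundji points\<close>

text \<open>
  \<open>basic_nbhd U x\<close> and \<open>level U x\<close> are Borges's \<open>U\<^sub>x\<close> and \<open>n(U, x)\<close>.
\<close>

definition level :: "'a set \<Rightarrow> 'a \<Rightarrow> nat" where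
  "level U x = (LEAST n. x \<in> S U n)"

definition basic_nbhd :: "'a set \<Rightarrow> 'a \<Rightarrow> 'a set" where
  "basic_nbhd U x = S U (level U x) - Y closure_of S (topspace Y - {x}) (level U x)"

lemma openin_compl_singleton: "openin Y (topspace Y - {x})"
  using Hausdorff_imp_t1_space[OF Hausdorff] by (simp add: t1_space_openin_delete_alt)

lemma basic_nbhd:
  assumes U: "openin Y U" and x: "x \<in> U"
  shows "openin Y (basic_nbhd U x)" "x \<in> basic_nbhd U x" "basic_nbhd U x \<subseteq> U"
proof -
  show "openin Y (basic_nbhd U x)" unfolding basic_nbhd_def by (rule openin_S_diff[OF U])
  have "\<exists>n. x \<in> S U n" using S_cases[OF U x] by blast
  then have "x \<in> S U (level U x)" unfolding level_def by (rule LeastI_ex)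
  then show "x \<in> basic_nbhd U x"
    unfolding basic_nbhd_def using closure_S[OF openin_compl_singleton] by blast
  show "basic_nbhd U x \<subseteq> U" unfolding basic_nbhd_def using S_subset[OF U] by blast
qed

text \<open>Otherwise \<open>U\<close> misses \<open>y\<close>, and by monotonicity the stratum of
  \<open>U\<close> containing \<open>z\<close> lies in the stratum of the complement of
  \<open>y\<close> that \<open>basic_nbhd V y\<close> removes. When two neighbourhoods meet, the one
  of higher level behaves as the smaller one.\<close>

lemma basic_nbhd_meet:
  assumes U: "openin Y U" and z: "z \<in> basic_nbhd U x" "z \<in> basic_nbhd V y"
    and le: "level U x \<le> level V y" and y: "y \<in> topspace Y"
  shows "y \<in> U"
proof (rule ccontr)
  assume "y \<notin> U"
  then have "U \<subseteq> topspace Y - {y}" using openin_subset[OF U] by blast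
  then have "S U (level U x) \<subseteq> S (topspace Y - {y}) (level V y)"
    using S_mono[OF U openin_compl_singleton _ le] by blast
  then show False
    using z S_subset_closure[OF openin_compl_singleton] unfolding basic_nbhd_def by blast
qed

text \<open>\<open>a x\<close> is a point of \<open>X\<close> with a neighbourhood that reaches
  \<open>x\<close> at the highest possible level; this replaces an almost nearest point.\<close>

lemma exists_dugundji_points:
  assumes X: "closedin Y X" "X \<noteq> {}"
  obtains B a where "\<And>x. x \<in> topspace Y - X \<Longrightarrow> openin Y (B x) \<and> x \<in> B x \<and> B x \<subseteq> topspace Y - X \<and> a x \<in> X"
    "\<And>x0 U. openin Y U \<Longrightarrow> x0 \<in> X \<Longrightarrow> x0 \<in> U \<Longrightarrow>
       \<exists>N. openin Y N \<and> x0 \<in> N \<and> (\<forall>x\<in>topspace Y - X. N \<inter> B x \<noteq> {} \<longrightarrow> a x \<in> U)"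
proof -
  define W where "W = topspace Y - X"
  have oW: "openin Y W" unfolding W_def using X by auto
  have XY: "X \<subseteq> topspace Y" using X closedin_subset by blast
  define P where "P x U b \<longleftrightarrow> openin Y U \<and> b \<in> X \<and> b \<in> U \<and> x \<in> basic_nbhd U b" for x U b
  \<comment> \<open>If the level at \<open>b\<close> were at least that of \<open>x\<close> in
    \<open>W\<close>, then \<open>b\<close> would lie in \<open>W\<close>. Hence only finitely many
    levels compete and a maximum exists.\<close>
  have bound: "level U b < level W x" if "P x U b" "x \<in> W" for x U b
  proof (rule ccontr)
    assume "\<not> level U b < level W x"
    then have "b \<in> W"
      using that XY basic_nbhd(2)[OF oW \<open>x \<in> W\<close>] unfolding P_def
      by (intro basic_nbhd_meet[OF oW, of x x U b]) auto
    then show False using that unfolding P_def W_def by blast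
  qed
  have "\<exists>b\<in>X. \<forall>U' b'. P x U' b' \<longrightarrow> (\<exists>U. P x U b \<and> level U' b' \<le> level U b)" if x: "x \<in> W" for x
  proof (cases "\<exists>U b. P x U b")
    \<comment> \<open>If no neighbourhood of a point of \<open>X\<close> reaches \<open>x\<close>,
      any point of the nonempty \<open>X\<close> will do.\<close>
    case False
    then show ?thesis using X by blast
  next
    case True
    define L where "L = {level U b | U b. P x U b}"
    have "L \<subseteq> {..<level W x}" using bound x unfolding L_def by blast
    then have "finite L" by (rule finite_subset) simp
    moreover have "L \<noteq> {}" using True unfolding L_def by blast
    ultimately have "Max L \<in> L" and L_max: "l \<in> L \<Longrightarrow> l \<le> Max L" for l by auto
    then obtain U b where Ub: "P x U b" "Max L = level U b" unfolding L_def by blast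
    have "level U' b' \<le> level U b" if "P x U' b'" for U' b'
    proof -
      have "level U' b' \<in> L" using that unfolding L_def by blast
      from L_max[OF this] show ?thesis using Ub(2) by simp
    qed
    moreover have "b \<in> X" using Ub(1) unfolding P_def by blast
    ultimately show ?thesis using Ub(1) by blast
  qed
  then have "\<forall>x. \<exists>b. x \<in> W \<longrightarrow> b \<in> X \<and>
      (\<forall>U' b'. P x U' b' \<longrightarrow> (\<exists>U. P x U b \<and> level U' b' \<le> level U b))"
    by blast
  then obtain a where "\<forall>x. x \<in> W \<longrightarrow> a x \<in> X \<and>
      (\<forall>U' b'. P x U' b' \<longrightarrow> (\<exists>U. P x U (a x) \<and> level U' b' \<le> level U (a x)))"
    by (rule choice[THEN exE])
  then have a: "x \<in> W \<Longrightarrow> a x \<in> X"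
    and a_max: "x \<in> W \<Longrightarrow> P x U' b' \<Longrightarrow> \<exists>U. P x U (a x) \<and> level U' b' \<le> level U (a x)" for x U' b'
    by simp_all
  show thesis
  proof (rule that[of "basic_nbhd W" a])
    show "openin Y (basic_nbhd W x) \<and> x \<in> basic_nbhd W x \<and> basic_nbhd W x \<subseteq> topspace Y - X \<and> a x \<in> X"
      if "x \<in> topspace Y - X" for x
      using basic_nbhd[OF oW, of x] a that unfolding W_def by blast
    fix x0 U assume U: "openin Y U" and x0: "x0 \<in> X" "x0 \<in> U"
    \<comment> \<open>The neighbourhood of \<open>x0\<close> is formed twice. Meeting
      \<open>basic_nbhd U1 x0\<close> forces \<open>x \<in> U1\<close>, so that \<open>x0\<close>
      itself competes for \<open>a x\<close>; maximality of the level then forces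
      \<open>a x \<in> U\<close>.\<close>
    define U1 where "U1 = basic_nbhd U x0"
    have U1: "openin Y U1" "x0 \<in> U1" "U1 \<subseteq> U" unfolding U1_def by (rule basic_nbhd[OF U x0(2)])+
    have "a x \<in> U" if x: "x \<in> W" and z: "z \<in> basic_nbhd U1 x0" "z \<in> basic_nbhd W x" for x z
    proof -
      have "\<not> level W x \<le> level U1 x0"
        using basic_nbhd_meet[OF oW z(2,1)] x0(1) XY unfolding W_def by blast
      then have "x \<in> U1"
        using x oW openin_subset by (intro basic_nbhd_meet[OF U1(1) z]) auto
      then have "P x U x0" using U x0 unfolding P_def U1_def by blast
      then obtain U' where U': "P x U' (a x)" "level U x0 \<le> level U' (a x)"
        using a_max[OF x] by blast
      then show ?thesis
        using \<open>x \<in> U1\<close> a[OF x] XY unfolding U1_def P_def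
        by (intro basic_nbhd_meet[OF U, of x x0 U' "a x"]) auto
    qed
    then show "\<exists>N. openin Y N \<and> x0 \<in> N \<and>
        (\<forall>x\<in>topspace Y - X. N \<inter> basic_nbhd W x \<noteq> {} \<longrightarrow> a x \<in> U)"
      using basic_nbhd[OF U1(1,2)] unfolding W_def by (intro exI[of _ "basic_nbhd U1 x0"]) blast
  qed
qed

end

section \<open>The Hartman--Mycielski construction\<close>

text \<open>
  \<open>h y\<close> is a step function on \<open>[0, 1)\<close> with values in \<open>X\<close>, i.e. a point of the Hartman--Mycielski
  space of \<open>X\<close>; \<open>h_nbhd\<close>, \<open>h_local\<close> and \<open>h_L1\<close> express the continuity of \<open>h\<close>.
\<close>

locale step_map =
  fixes Y :: "'a topology" and X :: "'a set" and h :: "'a \<Rightarrow> real \<Rightarrow> 'a"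
  assumes X_subset: "X \<subseteq> topspace Y"
    and h_in: "y \<in> topspace Y \<Longrightarrow> t \<in> {0..<1} \<Longrightarrow> h y t \<in> X"
    and h_fixed: "x \<in> X \<Longrightarrow> h x t = x"
    and h_finite: "y \<in> topspace Y \<Longrightarrow> finite (h y ` {0..<1})"
    and h_borel: "y \<in> topspace Y \<Longrightarrow> {t \<in> {0..<1}. h y t = a} \<in> sets borel"
    and h_nbhd: "x \<in> X \<Longrightarrow> openin Y U \<Longrightarrow> x \<in> U \<Longrightarrow>
      \<exists>N. openin Y N \<and> x \<in> N \<and> (\<forall>y\<in>N. \<forall>t\<in>{0..<1}. h y t \<in> U)"
    and h_local: "y \<in> topspace Y - X \<Longrightarrow>
      \<exists>F N. finite F \<and> F \<subseteq> X \<and> openin Y N \<and> y \<in> N \<and> (\<forall>z\<in>N. \<forall>t\<in>{0..<1}. h z t \<in> F)"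
    and h_L1: "y \<in> topspace Y - X \<Longrightarrow> e > 0 \<Longrightarrow> \<exists>N. openin Y N \<and> y \<in> N \<and>
      (\<forall>z\<in>N. \<exists>D\<in>fmeasurable lborel. measure lborel D < e \<and> (\<forall>t\<in>{0..<1} - D. h z t = h y t))"

section \<open>Breaking the unit interval\<close>

locale stick_breaking =
  fixes Y :: "'a topology" and u :: "nat \<Rightarrow> 'a \<Rightarrow> real"
  assumes u_cont: "\<And>j. continuous_map Y euclideanreal (u j)"
    and u_bounds: "\<And>j y. y \<in> topspace Y \<Longrightarrow> u j y \<in> {0..1}"
begin

text \<open>The product is what is left after \<open>j\<close> breaks. So piece \<open>j\<close>
  runs from \<open>stick j y\<close> to \<open>stick (Suc j) y\<close>, and a factor
  \<open>u k y\<close> equal to 1 uses up the rest.\<close>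

definition stick :: "nat \<Rightarrow> 'a \<Rightarrow> real" where
  "stick j y = 1 - (\<Prod>k<j. 1 - u k y)"

definition piece :: "'a \<Rightarrow> real \<Rightarrow> nat" where
  "piece y t = (LEAST j. t < stick (Suc j) y)"

lemma continuous_map_stick: "continuous_map Y euclideanreal (stick j)"
  unfolding stick_def using u_cont
  by (intro continuous_map_diff continuous_map_prod) auto

lemma stick_0: "stick 0 y = 0"
  by (simp add: stick_def)

lemma prod_compl_bounds:
  assumes "y \<in> topspace Y"
  shows "0 \<le> (\<Prod>k<j. 1 - u k y)" "(\<Prod>k<j. 1 - u k y) \<le> 1"
  using u_bounds[OF assms] by (auto intro!: prod_nonneg prod_le_1)

lemma stick_Suc: "stick (Suc j) y = stick j y + u j y * (\<Prod>k<j. 1 - u k y)"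
  by (simp add: stick_def algebra_simps)

lemma stick_mono:
  assumes "y \<in> topspace Y" "i \<le> j"
  shows "stick i y \<le> stick j y"
  using assms(2)
proof (rule lift_Suc_mono_le[rotated])
  show "stick n y \<le> stick (Suc n) y" for n
    using u_bounds[OF assms(1), of n] prod_compl_bounds[OF assms(1)] by (simp add: stick_Suc)
qed

lemma stick_eq_1:
  assumes "u k y = 1" "k < j"
  shows "stick j y = 1"
proof -
  have "(\<Prod>i<j. 1 - u i y) = 0" using assms by (intro prod_zero) auto
  then show ?thesis by (simp add: stick_def)
qed

lemma piece_eqI:
  assumes y: "y \<in> topspace Y" and t: "stick j y \<le> t" "t < stick (Suc j) y"
  shows "piece y t = j"
  unfolding piece_def
proof (rule Least_equality)
  fix i assume "t < stick (Suc i) y"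
  show "j \<le> i"
  proof (rule ccontr)
    assume "\<not> j \<le> i"
    then have "stick (Suc i) y \<le> stick j y" by (intro stick_mono y) simp
    then show False using t \<open>t < stick (Suc i) y\<close> by simp
  qed
qed (rule t)

text \<open>A break with \<open>u k y = 1\<close> ensures that the least index exists, and a piece
  containing a point has positive length, which forces its \<open>u\<close> to be positive.\<close>

lemma piece:
  assumes y: "y \<in> topspace Y" and k: "u k y = 1" and t: "t \<in> {0..<1}"
  shows "piece y t \<le> k" "stick (piece y t) y \<le> t" "t < stick (Suc (piece y t)) y"
    "u (piece y t) y > 0"
proof -
  have ex: "t < stick (Suc k) y" using stick_eq_1[OF k, of "Suc k"] t by simp
  then show "piece y t \<le> k" unfolding piece_def by (rule Least_le)
  show lt: "t < stick (Suc (piece y t)) y" unfolding piece_def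
    by (rule LeastI[where P = "\<lambda>j. t < stick (Suc j) y", OF ex])
  show le: "stick (piece y t) y \<le> t"
  proof (cases "piece y t")
    case 0
    then show ?thesis using t by (simp add: stick_0)
  next
    case (Suc i)
    then have "\<not> t < stick (Suc i) y" unfolding piece_def
      using not_less_Least[of i "\<lambda>j. t < stick (Suc j) y"] by simp
    then show ?thesis using Suc by simp
  qed
  have "u (piece y t) y * (\<Prod>i<piece y t. 1 - u i y) > 0"
    using le lt stick_Suc[of "piece y t" y] by linarith
  then show "u (piece y t) y > 0"
    using prod_compl_bounds(1)[OF y, of "piece y t"] by (simp add: zero_less_mult_iff)
qed

text \<open>Two breakpoints compare differently with \<open>t\<close> only if \<open>t\<close> lies
  between them, so \<open>D\<close> is the union of the intervals between corresponding
  breakpoints.\<close>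

lemma stick_diff_set:
  assumes y: "y \<in> topspace Y" and e: "e > 0"
  shows "\<exists>N. openin Y N \<and> y \<in> N \<and> (\<forall>z\<in>N. \<exists>D\<in>fmeasurable lborel. measure lborel D < e \<and>
    (\<forall>t. \<forall>j\<le>k. t \<notin> D \<longrightarrow> (t < stick (Suc j) z \<longleftrightarrow> t < stick (Suc j) y)))"
proof -
  \<comment> \<open>There are \<open>k + 1\<close> intervals of length at most \<open>d\<close>, of
    total length at most \<open>e / 2\<close>.\<close>
  define d where "d = e / (2 * (real k + 1))"
  have d: "d > 0" using e by (simp add: d_def)
  have "\<forall>j. \<exists>N. openin Y N \<and> y \<in> N \<and> (\<forall>z\<in>N. \<bar>stick (Suc j) z - stick (Suc j) y\<bar> < d)"
    using continuous_map_stick y d unfolding continuous_map_real_iff by simp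
  then obtain N where N: "\<forall>j. openin Y (N j) \<and> y \<in> N j \<and>
      (\<forall>z\<in>N j. \<bar>stick (Suc j) z - stick (Suc j) y\<bar> < d)"
    by (rule choice[THEN exE])
  have "\<exists>D\<in>fmeasurable lborel. measure lborel D < e \<and>
      (\<forall>t. \<forall>j\<le>k. t \<notin> D \<longrightarrow> (t < stick (Suc j) z \<longleftrightarrow> t < stick (Suc j) y))"
    if z: "z \<in> topspace Y \<inter> (\<Inter>j\<in>{..k}. N j)" for z
  proof -
    define I where "I j = {min (stick (Suc j) z) (stick (Suc j) y)..max (stick (Suc j) z) (stick (Suc j) y)}" for j
    have I: "I j \<in> fmeasurable lborel" for j
      by (auto simp: I_def emeasure_lborel_Icc_eq intro!: fmeasurableI)
    have mI: "measure lborel (I j) \<le> d" if "j \<le> k" for j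
    proof -
      have "\<bar>stick (Suc j) z - stick (Suc j) y\<bar> < d" using N z that by auto
      then show ?thesis by (simp add: I_def min_def max_def abs_if split: if_splits)
    qed
    have "measure lborel (\<Union>j\<in>{..k}. I j) \<le> (\<Sum>j\<in>{..k}. measure lborel (I j))"
      using I[THEN fmeasurableD] by (intro measure_UNION_le) auto
    also have "\<dots> \<le> (\<Sum>j\<in>{..k}. d)" using mI by (intro sum_mono) simp
    also have "\<dots> = e / 2" by (simp add: d_def field_simps)
    also have "\<dots> < e" using e by simp
    finally have "measure lborel (\<Union>j\<in>{..k}. I j) < e" .
    moreover have "(\<Union>j\<in>{..k}. I j) \<in> fmeasurable lborel" using I by (intro fmeasurable.finite_UN) auto
    moreover have "t < stick (Suc j) z \<longleftrightarrow> t < stick (Suc j) y"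
      if "j \<le> k" "t \<notin> (\<Union>j\<in>{..k}. I j)" for t j
    proof -
      have "t \<notin> I j" using that by blast
      then show ?thesis by (auto simp: I_def min_def max_def split: if_splits)
    qed
    ultimately show ?thesis by (intro bexI[of _ "\<Union>j\<in>{..k}. I j"]) simp_all
  qed
  moreover have "openin Y (topspace Y \<inter> (\<Inter>j\<in>{..k}. N j))"
    using N by (intro openin_Inter_finite) auto
  moreover have "y \<in> topspace Y \<inter> (\<Inter>j\<in>{..k}. N j)" using N y by simp
  ultimately show ?thesis by (intro exI[of _ "topspace Y \<inter> (\<Inter>j\<in>{..k}. N j)"]) simp
qed

end

theorem (in stratification) exists_step_map:
  assumes X: "closedin Y X" "X \<noteq> {}"
  shows "\<exists>h. step_map Y X h"
proof (rule exists_dugundji_points[OF X])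
  define W where "W = topspace Y - X"
  have XY: "X \<subseteq> topspace Y" using X closedin_subset by blast
  fix B :: "'a \<Rightarrow> 'a set" and a
  assume Ba: "\<And>x. x \<in> topspace Y - X \<Longrightarrow>
      openin Y (B x) \<and> x \<in> B x \<and> B x \<subseteq> topspace Y - X \<and> a x \<in> X"
    and dug: "\<And>x0 U. openin Y U \<Longrightarrow> x0 \<in> X \<Longrightarrow> x0 \<in> U \<Longrightarrow>
      \<exists>N. openin Y N \<and> x0 \<in> N \<and> (\<forall>x\<in>topspace Y - X. N \<inter> B x \<noteq> {} \<longrightarrow> a x \<in> U)"
  \<comment> \<open>The index type is all of \<open>'a\<close>; the empty sets keep the family from
    covering more than \<open>W\<close>.\<close>
  define U where "U x = (if x \<in> W then B x else {})" for x
  have U: "openin Y (U x)" for x using Ba by (simp add: U_def W_def)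
  have UW: "(\<Union>x. U x) = W" using Ba unfolding U_def W_def by auto
  show "\<exists>h. step_map Y X h"
  proof (rule exists_locally_constant_partition[where U = U, OF U])
    fix u :: "nat \<Rightarrow> 'a \<Rightarrow> real" and c
    assume u: "\<And>j. continuous_map Y euclideanreal (u j)" "\<And>j y. y \<in> topspace Y \<Longrightarrow> u j y \<in> {0..1}"
      and uU: "\<And>j y. y \<in> topspace Y \<Longrightarrow> u j y > 0 \<Longrightarrow> y \<in> U (c j y)"
      and loc: "\<And>y. y \<in> (\<Union>i. U i) \<Longrightarrow> \<exists>N k. openin Y N \<and> y \<in> N \<and>
         (\<forall>z\<in>N. u k z = 1 \<and> (\<forall>j\<le>k. u j z > 0 \<longrightarrow> c j z = c j y))"
    interpret stick_breaking Y u by standard (fact u)+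
    have loc: "\<exists>N k. openin Y N \<and> y \<in> N \<and>
         (\<forall>z\<in>N. u k z = 1 \<and> (\<forall>j\<le>k. u j z > 0 \<longrightarrow> c j z = c j y))" if "y \<in> W" for y
      using loc[of y] that unfolding UW by simp
    have some_1: "\<exists>k. u k y = 1" if "y \<in> W" for y using loc[OF that] by blast
    have WY: "y \<in> topspace Y" if "y \<in> W" for y using that by (simp add: W_def)
    define p where "p = piece"
    \<comment> \<open>For \<open>t\<close> in the unit interval the label of its piece is a point of
      \<open>W\<close> whose set contains \<open>y\<close>; the Dugundji point of that label is the
      value.\<close>
    define h where "h y t = (if y \<in> W then a (c (p y t) y) else y)" for y t
    have p: "u (p y t) y > 0" if "y \<in> W" "t \<in> {0..<1}" for y t
      using some_1[OF that(1)] piece(4)[OF WY[OF that(1)] _ that(2)] unfolding p_def by blast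
    have p_le: "p y t \<le> k" if "y \<in> W" "t \<in> {0..<1}" "u k y = 1" for y t k
      using piece(1)[OF WY[OF that(1)] that(3,2)] unfolding p_def .
    have c: "c (p y t) y \<in> W \<and> y \<in> B (c (p y t) y)" if "y \<in> W" "t \<in> {0..<1}" for y t
      using uU[OF WY[OF that(1)] p[OF that]] by (simp add: U_def split: if_splits)
    have h_X: "h y t \<in> X" if "y \<in> topspace Y" "t \<in> {0..<1}" for y t
      using that c[of y t] Ba unfolding h_def W_def by auto
    have step: "step_map Y X h"
    proof
      show "X \<subseteq> topspace Y" by fact
      show "h y t \<in> X" if "y \<in> topspace Y" "t \<in> {0..<1}" for y t using h_X that .
      show "h x t = x" if "x \<in> X" for x t using that by (simp add: h_def W_def)
      show "finite (h y ` {0..<1})" if y: "y \<in> topspace Y" for y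
      proof (cases "y \<in> W")
        case True
        obtain k where k: "u k y = 1" using some_1[OF True] by blast
        have "h y ` {0..<1} \<subseteq> (\<lambda>j. a (c j y)) ` {..k}"
          using p_le[OF True _ k] True by (auto simp: h_def)
        then show ?thesis by (rule finite_subset) simp
      next
        case False
        then have "h y ` {0..<1} \<subseteq> {y}" by (auto simp: h_def)
        then show ?thesis by (rule finite_subset) simp
      qed
      show "{t \<in> {0..<1}. h y t = b} \<in> sets borel" if y: "y \<in> topspace Y" for y b
      proof (cases "y \<in> W")
        case True
        obtain k where k: "u k y = 1" using some_1[OF True] by blast
        \<comment> \<open>Different pieces may carry the same value, so a fibre is a finite union of
          intervals.\<close>
        define J where "J = {j. j \<le> k \<and> a (c j y) = b}"
        have "{t \<in> {0..<1}. h y t = b} = (\<Union>j\<in>J. {stick j y..<stick (Suc j) y} \<inter> {0..<1})"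
        proof (intro equalityI subsetI)
          fix t assume "t \<in> {t \<in> {0..<1}. h y t = b}"
          then have t: "t \<in> {0..<1}" "a (c (p y t) y) = b" using True by (auto simp: h_def)
          then have "p y t \<in> J" using p_le[OF True t(1) k] by (simp add: J_def)
          moreover have "t \<in> {stick (p y t) y..<stick (Suc (p y t)) y}"
            using piece(2,3)[OF y k t(1)] by (simp add: p_def)
          ultimately show "t \<in> (\<Union>j\<in>J. {stick j y..<stick (Suc j) y} \<inter> {0..<1})"
            using t(1) by blast
        next
          fix t assume "t \<in> (\<Union>j\<in>J. {stick j y..<stick (Suc j) y} \<inter> {0..<1})"
          then obtain j where j: "j \<in> J" "stick j y \<le> t" "t < stick (Suc j) y" "t \<in> {0..<1}"
            by auto
          then have "p y t = j" using piece_eqI[OF y j(2,3)] by (simp add: p_def)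
          then show "t \<in> {t \<in> {0..<1}. h y t = b}" using j True by (simp add: h_def J_def)
        qed
        moreover have "finite J" by (simp add: J_def)
        ultimately show ?thesis by simp
      next
        case False
        then have "{t \<in> {0..<1}. h y t = b} = (if y = b then {0..<1} else {})" by (auto simp: h_def)
        then show ?thesis by simp
      qed
      show "\<exists>N. openin Y N \<and> x \<in> N \<and> (\<forall>y\<in>N. \<forall>t\<in>{0..<1}. h y t \<in> V)"
        if x: "x \<in> X" and V: "openin Y V" "x \<in> V" for x V
      proof -
        obtain N where N: "openin Y N" "x \<in> N"
          and NV: "\<forall>x'\<in>topspace Y - X. N \<inter> B x' \<noteq> {} \<longrightarrow> a x' \<in> V"
          using dug[OF V(1) x V(2)] by blast
        \<comment> \<open>For \<open>y\<close> in \<open>W\<close>, the set of the label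
          \<open>c (p y t) y\<close> contains \<open>y\<close> and so meets \<open>N\<close>, which
          puts the value in \<open>V\<close>.\<close>
        have "h y t \<in> V" if y: "y \<in> N \<inter> V" and t: "t \<in> {0..<1}" for y t
        proof (cases "y \<in> W")
          case True
          have "c (p y t) y \<in> topspace Y - X" "y \<in> N \<inter> B (c (p y t) y)"
            using c[OF True t] y unfolding W_def by auto
          then have "a (c (p y t) y) \<in> V" using NV by blast
          then show ?thesis using True by (simp add: h_def)
        next
          case False
          then show ?thesis using y by (simp add: h_def)
        qed
        then show ?thesis using N V by (intro exI[of _ "N \<inter> V"]) (simp add: openin_Int)
      qed
      show "\<exists>F N. finite F \<and> F \<subseteq> X \<and> openin Y N \<and> y \<in> N \<and> (\<forall>z\<in>N. \<forall>t\<in>{0..<1}. h z t \<in> F)"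
        if "y \<in> topspace Y - X" for y
      proof -
        have y: "y \<in> W" using that by (simp add: W_def)
        obtain N k where N: "openin Y N" "y \<in> N"
          and k: "\<And>z. z \<in> N \<Longrightarrow> u k z = 1" "\<And>z j. z \<in> N \<Longrightarrow> j \<le> k \<Longrightarrow> u j z > 0 \<Longrightarrow> c j z = c j y"
          using loc[OF y] by blast
        have oW: "openin Y W" unfolding W_def using X by auto
        have "h z t \<in> (\<lambda>j. a (c j y)) ` {..k} \<inter> X" if z: "z \<in> N \<inter> W" and t: "t \<in> {0..<1}" for z t
        proof -
          have zW: "z \<in> W" and zN: "z \<in> N" using z by auto
          have le: "p z t \<le> k" by (rule p_le[OF zW t k(1)[OF zN]])
          have "h z t = a (c (p z t) y)" using k(2)[OF zN le p[OF zW t]] zW by (simp add: h_def)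
          then show ?thesis using le h_X[OF WY[OF zW] t] by auto
        qed
        then show ?thesis using N oW y
          by (intro exI[of _ "(\<lambda>j. a (c j y)) ` {..k} \<inter> X"] exI[of _ "N \<inter> W"]) (simp add: openin_Int)
      qed
      show "\<exists>N. openin Y N \<and> y \<in> N \<and>
          (\<forall>z\<in>N. \<exists>D\<in>fmeasurable lborel. measure lborel D < e \<and> (\<forall>t\<in>{0..<1} - D. h z t = h y t))"
        if "y \<in> topspace Y - X" and e: "e > 0" for y e
      proof -
        have y: "y \<in> W" using that by (simp add: W_def)
        have oW: "openin Y W" unfolding W_def using X by auto
        obtain N k where N: "openin Y N" "y \<in> N"
          and k: "\<And>z. z \<in> N \<Longrightarrow> u k z = 1" "\<And>z j. z \<in> N \<Longrightarrow> j \<le> k \<Longrightarrow> u j z > 0 \<Longrightarrow> c j z = c j y"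
          using loc[OF y] by blast
        obtain N' where N': "openin Y N'" "y \<in> N'"
          and D: "\<forall>z\<in>N'. \<exists>D\<in>fmeasurable lborel. measure lborel D < e \<and>
            (\<forall>t. \<forall>j\<le>k. t \<notin> D \<longrightarrow> (t < stick (Suc j) z \<longleftrightarrow> t < stick (Suc j) y))"
          using stick_diff_set[OF WY[OF y] e, of k] by blast
        have "\<exists>D\<in>fmeasurable lborel. measure lborel D < e \<and> (\<forall>t\<in>{0..<1} - D. h z t = h y t)"
          if z: "z \<in> N \<inter> N' \<inter> W" for z
        proof -
          have zW: "z \<in> W" and zN: "z \<in> N" and zN': "z \<in> N'" using z by auto
          obtain D where D: "D \<in> fmeasurable lborel" "measure lborel D < e"
            and iff: "\<And>t j. j \<le> k \<Longrightarrow> t \<notin> D \<Longrightarrow> t < stick (Suc j) z \<longleftrightarrow> t < stick (Suc j) y"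
            using D zN' by blast
          have "h z t = h y t" if t: "t \<in> {0..<1}" "t \<notin> D" for t
          proof -
            \<comment> \<open>Beyond \<open>k\<close> both sticks are used up, so agreement up to
              \<open>k\<close> is agreement for all breakpoints, and \<open>t\<close> falls into the
              same piece.\<close>
            have "t < stick (Suc j) z \<longleftrightarrow> t < stick (Suc j) y" for j
            proof (cases "j \<le> k")
              case True
              then show ?thesis using iff t by blast
            next
              case False
              then have "stick (Suc j) z = 1" "stick (Suc j) y = 1"
                using stick_eq_1 k(1)[OF zN] k(1)[OF N(2)] by simp_all
              then show ?thesis by simp
            qed
            then have eq: "p z t = p y t" by (simp add: p_def piece_def)
            have le: "p z t \<le> k" by (rule p_le[OF zW t(1) k(1)[OF zN]])
            have "c (p z t) z = c (p z t) y" by (rule k(2)[OF zN le p[OF zW t(1)]])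
            then show ?thesis using zW y eq by (simp add: h_def)
          qed
          then show ?thesis using D by (intro bexI[of _ D]) auto
        qed
        then show ?thesis using N N' oW y
          by (intro exI[of _ "N \<inter> N' \<inter> W"]) (simp add: openin_Int)
      qed
    qed
    then show "\<exists>h. step_map Y X h" by (intro exI[of _ h])
  qed
qed

section \<open>Integrating over the steps\<close>

context step_map
begin

definition hm :: "('a \<times> 'a \<Rightarrow> real) \<Rightarrow> 'a \<times> 'a \<Rightarrow> real" where
  "hm p w = (\<integral>t. indicat_real {0..<1} t * p (h (fst w) t, h (snd w) t) \<partial>lborel)"

text \<open>The integrand takes finitely many values on measurable sets, whatever the function
  \<open>p\<close> is.\<close>

lemma integrable_hm:
  assumes y: "y \<in> topspace Y" and z: "z \<in> topspace Y"
  shows "integrable lborel (\<lambda>t. indicat_real {0..<1} t * p (h y t, h z t))"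
proof -
  define R where "R = h y ` {0..<1} \<times> h z ` {0..<1}"
  define E where "E w = {t \<in> {0..<1}. h y t = fst w} \<inter> {t \<in> {0..<1}. h z t = snd w}" for w
  have R: "finite R" unfolding R_def using h_finite y z by simp
  have E: "E w \<in> sets lborel" for w unfolding E_def using h_borel y z by simp
  have "emeasure lborel (E w) \<le> emeasure lborel {0..<1::real}" for w
    by (rule emeasure_mono) (auto simp: E_def)
  then have fin: "emeasure lborel (E w) < \<infinity>" for w
    by (rule le_less_trans) simp
  have "integrable lborel (\<lambda>t. \<Sum>w\<in>R. p w * indicat_real (E w) t)"
    using E fin by (intro Bochner_Integration.integrable_sum integrable_mult_right integrable_real_indicator)
  moreover have "(\<Sum>w\<in>R. p w * indicat_real (E w) t) = indicat_real {0..<1} t * p (h y t, h z t)" for t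
  proof (cases "t \<in> {0..<1}")
    case True
    have "(\<Sum>w\<in>R. p w * indicat_real (E w) t) = (\<Sum>w\<in>R. if w = (h y t, h z t) then p w else 0)"
      using True by (intro sum.cong) (auto simp: E_def indicator_def)
    also have "\<dots> = p (h y t, h z t)" using R True by (simp add: R_def)
    finally show ?thesis using True by simp
  next
    case False
    then have "(\<Sum>w\<in>R. p w * indicat_real (E w) t) = 0"
      by (intro sum.neutral) (auto simp: E_def indicator_def)
    then show ?thesis using False by simp
  qed
  ultimately show ?thesis by simp
qed

lemma hm_eq: "hm p (y, z) = (\<integral>t. indicat_real {0..<1} t * p (h y t, h z t) \<partial>lborel)"
  by (simp add: hm_def)

lemma hm_mono:
  assumes "y \<in> topspace Y" "z \<in> topspace Y" "\<And>t. t \<in> {0..<1} \<Longrightarrow> p (h y t, h z t) \<le> q (h y t, h z t)"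
  shows "hm p (y, z) \<le> hm q (y, z)"
  unfolding hm_eq
  by (intro integral_mono integrable_hm assms(1,2)) (auto simp: indicator_def assms(3))

lemma hm_cong:
  assumes "y \<in> topspace Y" "z \<in> topspace Y" "\<And>w. w \<in> X \<times> X \<Longrightarrow> p w = q w"
  shows "hm p (y, z) = hm q (y, z)"
proof -
  have "p (h y t, h z t) = q (h y t, h z t)" if "t \<in> {0..<1}" for t
    using assms h_in that by simp
  then show ?thesis
    using assms(1,2) by (intro antisym hm_mono) auto
qed

lemma hm_add:
  assumes "y \<in> topspace Y" "z \<in> topspace Y"
  shows "hm (\<lambda>w. p w + q w) (y, z) = hm p (y, z) + hm q (y, z)"
  unfolding hm_eq distrib_left
  by (rule Bochner_Integration.integral_add; rule integrable_hm[OF assms])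

lemma hm_cmult: "hm (\<lambda>w. c * p w) (y, z) = c * hm p (y, z)"
  unfolding hm_eq by (simp add: mult.left_commute)

lemma hm_const: "hm (\<lambda>w. c) (y, z) = c"
  by (simp add: hm_eq)

lemma hm_fixed: "x \<in> X \<Longrightarrow> x' \<in> X \<Longrightarrow> hm p (x, x') = p (x, x')"
  by (simp add: hm_eq h_fixed)

lemma hm_diff_le:
  assumes y: "y \<in> topspace Y" "z \<in> topspace Y"
    and e: "\<And>t. t \<in> {0..<1} \<Longrightarrow> \<bar>p (h y t, h z t) - q (h y t, h z t)\<bar> \<le> e"
  shows "\<bar>hm p (y, z) - hm q (y, z)\<bar> \<le> e"
proof -
  have "p (h y t, h z t) \<le> q (h y t, h z t) + e" "q (h y t, h z t) \<le> p (h y t, h z t) + e"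
    if "t \<in> {0..<1}" for t
    using e[OF that] by linarith+
  then have "hm p (y, z) \<le> hm (\<lambda>w. q w + e) (y, z)" "hm q (y, z) \<le> hm (\<lambda>w. p w + e) (y, z)"
    using y by (intro hm_mono; simp)+
  then show ?thesis using y by (simp add: hm_add hm_const abs_le_iff)
qed

lemma pseudometric_on_hm:
  assumes p: "pseudometric_on X p"
  shows "pseudometric_on (topspace Y) (hm p)"
proof -
  have pos: "0 \<le> p (x, y)" and sym: "p (x, y) = p (y, x)" if "x \<in> X" "y \<in> X" for x y
    using p that unfolding pseudometric_on_def by simp_all
  have zero: "p (x, x) = 0" if "x \<in> X" for x
    using p that unfolding pseudometric_on_def by simp
  have triangle: "p (x, z) \<le> p (x, y) + p (y, z)" if "x \<in> X" "y \<in> X" "z \<in> X" for x y z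
    using p that unfolding pseudometric_on_def by simp
  have hX: "h y t \<in> X" if "y \<in> topspace Y" "t \<in> {0..<1}" for y t using h_in that .
  have "0 \<le> hm p (x, y)" if "x \<in> topspace Y" "y \<in> topspace Y" for x y
  proof -
    have "hm (\<lambda>_. 0) (x, y) \<le> hm p (x, y)" using that by (intro hm_mono pos hX)
    then show ?thesis by (simp add: hm_const)
  qed
  moreover have "hm p (x, x) = 0" if x: "x \<in> topspace Y" for x
  proof -
    have "\<bar>hm p (x, x) - hm (\<lambda>_. 0) (x, x)\<bar> \<le> 0"
      using x zero hX by (intro hm_diff_le) auto
    then show ?thesis by (simp add: hm_const)
  qed
  moreover have "hm p (x, y) = hm p (y, x)" if "x \<in> topspace Y" "y \<in> topspace Y" for x y
  proof -
    have "indicat_real {0..<1} t * p (h x t, h y t) = indicat_real {0..<1} t * p (h y t, h x t)" for t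
      using sym hX that by (cases "t \<in> {0..<1}") auto
    then show ?thesis unfolding hm_eq by (simp only:)
  qed
  moreover have "hm p (x, z) \<le> hm p (x, y) + hm p (y, z)"
    if xyz: "x \<in> topspace Y" "y \<in> topspace Y" "z \<in> topspace Y" for x y z
  proof -
    have "hm p (x, z) \<le> (\<integral>t. indicat_real {0..<1} t * p (h x t, h y t) +
        indicat_real {0..<1} t * p (h y t, h z t) \<partial>lborel)"
      unfolding hm_eq
    proof (intro integral_mono Bochner_Integration.integrable_add integrable_hm xyz)
      fix t
      show "indicat_real {0..<1} t * p (h x t, h z t) \<le> indicat_real {0..<1} t * p (h x t, h y t) +
          indicat_real {0..<1} t * p (h y t, h z t)"
        using triangle hX xyz by (cases "t \<in> {0..<1}") auto
    qed
    also have "\<dots> = hm p (x, y) + hm p (y, z)"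
      unfolding hm_eq by (intro Bochner_Integration.integral_add integrable_hm xyz)
    finally show ?thesis .
  qed
  ultimately show ?thesis unfolding pseudometric_on_def by simp
qed

text \<open>Away from \<open>X\<close> one can take \<open>k = h y\<close>, at a point \<open>y0\<close> of \<open>X\<close> the constant function \<open>y0\<close>.\<close>

lemma step_approximation:
  assumes y0: "y0 \<in> topspace Y"
  shows "\<exists>F. finite F \<and> F \<subseteq> X \<and> (\<forall>t\<in>{0..<1}. h y0 t \<in> F) \<and>
    (\<forall>V e. (\<forall>f\<in>F. openin Y (V f) \<and> f \<in> V f) \<longrightarrow> e > 0 \<longrightarrow>
      (\<exists>N. openin Y N \<and> y0 \<in> N \<and> (\<forall>y\<in>N. \<exists>k. \<exists>D\<in>fmeasurable lborel. measure lborel D < e \<and>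
        (\<forall>t\<in>{0..<1}. k t \<in> F \<and> h y t \<in> V (k t)) \<and> (\<forall>t\<in>{0..<1} - D. k t = h y0 t))))"
proof (cases "y0 \<in> X")
  case True
  have "\<exists>N. openin Y N \<and> y0 \<in> N \<and> (\<forall>y\<in>N. \<exists>k. \<exists>D\<in>fmeasurable lborel. measure lborel D < e \<and>
      (\<forall>t\<in>{0..<1}. k t \<in> {y0} \<and> h y t \<in> V (k t)) \<and> (\<forall>t\<in>{0..<1} - D. k t = h y0 t))"
    if V: "\<forall>f\<in>{y0}. openin Y (V f) \<and> f \<in> V f" and e: "e > 0" for V e
  proof -
    obtain N where N: "openin Y N" "y0 \<in> N" "\<forall>y\<in>N. \<forall>t\<in>{0..<1}. h y t \<in> V y0"
      using h_nbhd[OF True, of "V y0"] V by blast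
    have "\<exists>k. \<exists>D\<in>fmeasurable lborel. measure lborel D < e \<and>
      (\<forall>t\<in>{0..<1}. k t \<in> {y0} \<and> h y t \<in> V (k t)) \<and> (\<forall>t\<in>{0..<1} - D. k t = h y0 t)" if "y \<in> N" for y
      using N(3) that e True by (intro exI[of _ "\<lambda>_. y0"] bexI[of _ "{}"]) (auto simp: h_fixed)
    then show ?thesis using N by (intro exI[of _ N]) simp
  qed
  then show ?thesis using True by (intro exI[of _ "{y0}"]) (simp add: h_fixed)
next
  case False
  then have y0': "y0 \<in> topspace Y - X" using y0 by simp
  obtain F N where F: "finite F" "F \<subseteq> X" and N: "openin Y N" "y0 \<in> N"
    "\<forall>z\<in>N. \<forall>t\<in>{0..<1}. h z t \<in> F"
    using h_local[OF y0'] by blast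
  have "\<exists>N. openin Y N \<and> y0 \<in> N \<and> (\<forall>y\<in>N. \<exists>k. \<exists>D\<in>fmeasurable lborel. measure lborel D < e \<and>
      (\<forall>t\<in>{0..<1}. k t \<in> F \<and> h y t \<in> V (k t)) \<and> (\<forall>t\<in>{0..<1} - D. k t = h y0 t))"
    if V: "\<forall>f\<in>F. openin Y (V f) \<and> f \<in> V f" and e: "e > 0" for V e
  proof -
    obtain N' where N': "openin Y N'" "y0 \<in> N'"
      "\<forall>z\<in>N'. \<exists>D\<in>fmeasurable lborel. measure lborel D < e \<and> (\<forall>t\<in>{0..<1} - D. h z t = h y0 t)"
      using h_L1[OF y0' e] by blast
    have "\<exists>k. \<exists>D\<in>fmeasurable lborel. measure lborel D < e \<and>
      (\<forall>t\<in>{0..<1}. k t \<in> F \<and> h y t \<in> V (k t)) \<and> (\<forall>t\<in>{0..<1} - D. k t = h y0 t)"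
      if y: "y \<in> N \<inter> N'" for y
    proof -
      obtain D where "D \<in> fmeasurable lborel" "measure lborel D < e" "\<forall>t\<in>{0..<1} - D. h y t = h y0 t"
        using N'(3) y by blast
      moreover have "h y t \<in> F \<and> h y t \<in> V (h y t)" if "t \<in> {0..<1}" for t
        using N(3) V y that by simp
      ultimately show ?thesis by (intro exI[of _ "h y"] bexI[of _ D]) simp_all
    qed
    then show ?thesis using N N' by (intro exI[of _ "N \<inter> N'"]) (simp add: openin_Int)
  qed
  then show ?thesis using F N by (intro exI[of _ F]) simp
qed

text \<open>Near \<open>(y0, z0)\<close> the steps can be replaced by steps with values in finite
  sets, changing \<open>p\<close> by less than \<open>e / 2\<close>. Off a set of small measure
  these agree with the steps of \<open>y0\<close> and \<open>z0\<close>.\<close>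

lemma continuous_map_hm:
  assumes p: "continuous_map (prod_topology (subtopology Y X) (subtopology Y X)) euclideanreal p"
  shows "continuous_map (prod_topology Y Y) euclideanreal (hm p)"
  unfolding continuous_map_real_iff
proof (intro ballI allI impI)
  fix w and e :: real assume w: "w \<in> topspace (prod_topology Y Y)" and e: "e > 0"
  obtain y0 z0 where yz: "w = (y0, z0)" "y0 \<in> topspace Y" "z0 \<in> topspace Y" using w by auto
  \<comment> \<open>The finite sets precede \<open>V\<close> and \<open>e\<close> because the
    neighbourhoods and the tolerance \<open>d\<close> are built from \<open>F\<close> and
    \<open>F'\<close>.\<close>
  obtain F where F: "finite F" "F \<subseteq> X" "\<forall>t\<in>{0..<1}. h y0 t \<in> F"
    and FN: "\<forall>V e. (\<forall>f\<in>F. openin Y (V f) \<and> f \<in> V f) \<longrightarrow> e > 0 \<longrightarrow>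
      (\<exists>N. openin Y N \<and> y0 \<in> N \<and> (\<forall>y\<in>N. \<exists>k. \<exists>D\<in>fmeasurable lborel. measure lborel D < e \<and>
        (\<forall>t\<in>{0..<1}. k t \<in> F \<and> h y t \<in> V (k t)) \<and> (\<forall>t\<in>{0..<1} - D. k t = h y0 t)))"
    using step_approximation[OF yz(2)] by (elim exE conjE)
  obtain F' where F': "finite F'" "F' \<subseteq> X" "\<forall>t\<in>{0..<1}. h z0 t \<in> F'"
    and FN': "\<forall>V e. (\<forall>f\<in>F'. openin Y (V f) \<and> f \<in> V f) \<longrightarrow> e > 0 \<longrightarrow>
      (\<exists>N. openin Y N \<and> z0 \<in> N \<and> (\<forall>y\<in>N. \<exists>k. \<exists>D\<in>fmeasurable lborel. measure lborel D < e \<and>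
        (\<forall>t\<in>{0..<1}. k t \<in> F' \<and> h y t \<in> V (k t)) \<and> (\<forall>t\<in>{0..<1} - D. k t = h z0 t)))"
    using step_approximation[OF yz(3)] by (elim exE conjE)
  have "\<exists>A. openin Y (fst A) \<and> openin Y (snd A) \<and> f \<in> fst A \<and> f' \<in> snd A \<and>
      (\<forall>x\<in>fst A \<inter> X. \<forall>x'\<in>snd A \<inter> X. \<bar>p (x, x') - p (f, f')\<bar> < e / 2)"
    if f: "f \<in> F" "f' \<in> F'" for f f'
  proof -
    have ff: "f \<in> X" "f' \<in> X" using f F F' by auto
    then have "(f, f') \<in> topspace (prod_topology (subtopology Y X) (subtopology Y X))"
      using X_subset by auto
    then obtain Q where Q: "openin (prod_topology (subtopology Y X) (subtopology Y X)) Q"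
      "(f, f') \<in> Q" "\<forall>w\<in>Q. \<bar>p w - p (f, f')\<bar> < e / 2"
      using p[unfolded continuous_map_real_iff, rule_format, of "(f, f')" "e / 2"] e by auto
    from Q(1)[unfolded openin_prod_topology_alt, rule_format, OF Q(2)]
    obtain U U' where U: "openin (subtopology Y X) U" "openin (subtopology Y X) U'"
      "f \<in> U" "f' \<in> U'" "U \<times> U' \<subseteq> Q"
      by (elim exE conjE)
    obtain A where A: "openin Y A" "U = A \<inter> X" using U(1) by (auto simp: openin_subtopology)
    obtain A' where A': "openin Y A'" "U' = A' \<inter> X" using U(2) by (auto simp: openin_subtopology)
    have "\<bar>p (x, x') - p (f, f')\<bar> < e / 2" if "x \<in> A \<inter> X" "x' \<in> A' \<inter> X" for x x'
    proof -
      have "(x, x') \<in> Q" using that U(5) A(2) A'(2) by auto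
      then show ?thesis using Q(3) by blast
    qed
    then show ?thesis using A A' U by (intro exI[of _ "(A, A')"]) simp
  qed
  then have "\<forall>f. \<forall>f'. \<exists>A. f \<in> F \<longrightarrow> f' \<in> F' \<longrightarrow> openin Y (fst A) \<and> openin Y (snd A) \<and> f \<in> fst A \<and>
      f' \<in> snd A \<and> (\<forall>x\<in>fst A \<inter> X. \<forall>x'\<in>snd A \<inter> X. \<bar>p (x, x') - p (f, f')\<bar> < e / 2)"
    by simp
  then obtain A where A: "\<forall>f f'. f \<in> F \<longrightarrow> f' \<in> F' \<longrightarrow> openin Y (fst (A f f')) \<and>
      openin Y (snd (A f f')) \<and> f \<in> fst (A f f') \<and> f' \<in> snd (A f f') \<and>
      (\<forall>x\<in>fst (A f f') \<inter> X. \<forall>x'\<in>snd (A f f') \<inter> X. \<bar>p (x, x') - p (f, f')\<bar> < e / 2)"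
    by metis
  define V where "V f = topspace Y \<inter> (\<Inter>f'\<in>F'. fst (A f f'))" for f
  define V' where "V' f' = topspace Y \<inter> (\<Inter>f\<in>F. snd (A f f'))" for f'
  have V: "\<forall>f\<in>F. openin Y (V f) \<and> f \<in> V f"
  proof
    fix f assume f: "f \<in> F"
    have "openin Y (V f)" unfolding V_def using F'(1) A f by (intro openin_Inter_finite) simp_all
    moreover have "f \<in> V f" unfolding V_def using A f F(2) X_subset by auto
    ultimately show "openin Y (V f) \<and> f \<in> V f" ..
  qed
  have V': "\<forall>f\<in>F'. openin Y (V' f) \<and> f \<in> V' f"
  proof
    fix f assume f: "f \<in> F'"
    have "openin Y (V' f)" unfolding V'_def using F(1) A f by (intro openin_Inter_finite) simp_all
    moreover have "f \<in> V' f" unfolding V'_def using A f F'(2) X_subset by auto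
    ultimately show "openin Y (V' f) \<and> f \<in> V' f" ..
  qed
  have VV: "\<bar>p (x, x') - p (f, f')\<bar> < e / 2"
    if "f \<in> F" "f' \<in> F'" "x \<in> V f" "x' \<in> V' f'" "x \<in> X" "x' \<in> X" for f f' x x'
  proof -
    have "x \<in> fst (A f f') \<inter> X" "x' \<in> snd (A f f') \<inter> X" using that unfolding V_def V'_def by auto
    then show ?thesis using A that(1,2) by blast
  qed
  \<comment> \<open>The added 1 keeps \<open>M\<close> positive if \<open>p\<close> vanishes on the
    finite set.\<close>
  define M where "M = (\<Sum>w\<in>F \<times> F'. \<bar>p w\<bar>) + 1"
  have M: "M > 0" unfolding M_def by (intro add_nonneg_pos sum_nonneg) auto
  have pM: "\<bar>p (f, f')\<bar> \<le> M" if "f \<in> F" "f' \<in> F'" for f f'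
  proof -
    have "\<bar>p (f, f')\<bar> \<le> (\<Sum>w\<in>F \<times> F'. \<bar>p w\<bar>)"
      using that F(1) F'(1) by (intro member_le_sum) auto
    then show ?thesis by (simp add: M_def)
  qed
  \<comment> \<open>The two exceptional sets then contribute at most
    \<open>4 * M * d = e / 4\<close>.\<close>
  define d where "d = e / (16 * M)"
  have d: "d > 0" using M e by (simp add: d_def)
  obtain N where N: "openin Y N" "y0 \<in> N"
    and Nk: "\<forall>y\<in>N. \<exists>k. \<exists>D\<in>fmeasurable lborel. measure lborel D < d \<and>
        (\<forall>t\<in>{0..<1}. k t \<in> F \<and> h y t \<in> V (k t)) \<and> (\<forall>t\<in>{0..<1} - D. k t = h y0 t)"
    using FN[THEN spec, THEN spec, THEN mp, THEN mp, OF V d] by (elim exE conjE)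
  obtain N' where N': "openin Y N'" "z0 \<in> N'"
    and Nk': "\<forall>y\<in>N'. \<exists>k. \<exists>D\<in>fmeasurable lborel. measure lborel D < d \<and>
        (\<forall>t\<in>{0..<1}. k t \<in> F' \<and> h y t \<in> V' (k t)) \<and> (\<forall>t\<in>{0..<1} - D. k t = h z0 t)"
    using FN'[THEN spec, THEN spec, THEN mp, THEN mp, OF V' d] by (elim exE conjE)
  have "\<bar>hm p (y, z) - hm p (y0, z0)\<bar> < e" if yN: "y \<in> N" and zN: "z \<in> N'" for y z
  proof -
    have y: "y \<in> topspace Y" and z: "z \<in> topspace Y" using yN zN N N' openin_subset by auto
    obtain k D where D: "D \<in> fmeasurable lborel" "measure lborel D < d"
      and k: "\<forall>t\<in>{0..<1}. k t \<in> F \<and> h y t \<in> V (k t)" "\<forall>t\<in>{0..<1} - D. k t = h y0 t"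
      using Nk yN by blast
    obtain k' D' where D': "D' \<in> fmeasurable lborel" "measure lborel D' < d"
      and k': "\<forall>t\<in>{0..<1}. k' t \<in> F' \<and> h z t \<in> V' (k' t)" "\<forall>t\<in>{0..<1} - D'. k' t = h z0 t"
      using Nk' zN by blast
    \<comment> \<open>A majorant of the difference: \<open>e / 2\<close> for passing to the finite
      values, and \<open>2 * M\<close> on each set where these may differ from the values at the
      centre.\<close>
    define g where "g t = indicat_real {0..<1} t * (e / 2) +
      (2 * M * indicat_real D t + 2 * M * indicat_real D' t)" for t
    have int_D: "integrable lborel (indicat_real D)" "integrable lborel (indicat_real D')"
      using D D' by (auto simp: fmeasurable_def)
    then have int_g: "integrable lborel g"
      unfolding g_def by (intro Bochner_Integration.integrable_add integrable_mult_right) simp_all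
    have "integral\<^sup>L lborel g = e / 2 + (2 * M * measure lborel D + 2 * M * measure lborel D')"
      unfolding g_def using int_D D D' by (subst Bochner_Integration.integral_add; simp add: fmeasurable_def)+
    also have "\<dots> \<le> e / 2 + (2 * M * d + 2 * M * d)"
      using D D' M by (intro add_mono mult_left_mono) auto
    also have "\<dots> < e" using M e by (simp add: d_def field_simps)
    finally have g: "integral\<^sup>L lborel g < e" .
    have bound: "\<bar>indicat_real {0..<1} t * p (h y t, h z t) - indicat_real {0..<1} t * p (h y0 t, h z0 t)\<bar> \<le> g t"
      for t
    proof (cases "t \<in> {0..<1}")
      case True
      have hX: "h y t \<in> X" "h z t \<in> X" using h_in y z True by auto
      have 1: "\<bar>p (h y t, h z t) - p (k t, k' t)\<bar> < e / 2"
        using VV k(1) k'(1) True hX by blast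
      have 2: "\<bar>p (k t, k' t)\<bar> \<le> M" "\<bar>p (h y0 t, h z0 t)\<bar> \<le> M"
        using pM k(1) k'(1) True F(3) F'(3) by blast+
      show ?thesis
      proof (cases "t \<in> D \<union> D'")
        case in_D: True
        have "g t \<ge> e / 2 + 2 * M" using True in_D M by (auto simp: g_def indicator_def)
        then have "\<bar>p (h y t, h z t) - p (h y0 t, h z0 t)\<bar> \<le> g t" using 1 2 by linarith
        then show ?thesis using True by simp
      next
        case False
        then have "k t = h y0 t" "k' t = h z0 t" using k(2) k'(2) True by auto
        moreover have "g t = e / 2" using True False by (simp add: g_def)
        ultimately show ?thesis using 1 True by simp
      qed
    next
      case False
      have "g t \<ge> 0" using e M by (simp add: g_def)
      then show ?thesis using False by simp
    qed
    have int: "integrable lborel (\<lambda>t. indicat_real {0..<1} t * p (h y t, h z t))"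
      "integrable lborel (\<lambda>t. indicat_real {0..<1} t * p (h y0 t, h z0 t))"
      using y z yz by (auto intro: integrable_hm)
    define f where "f t = indicat_real {0..<1} t * p (h y t, h z t) -
      indicat_real {0..<1} t * p (h y0 t, h z0 t)" for t
    have int_f: "integrable lborel f"
      unfolding f_def using int by (rule Bochner_Integration.integrable_diff)
    have "hm p (y, z) - hm p (y0, z0) = integral\<^sup>L lborel f"
      unfolding hm_eq f_def using int by (rule Bochner_Integration.integral_diff[symmetric])
    then have "\<bar>hm p (y, z) - hm p (y0, z0)\<bar> \<le> (\<integral>t. \<bar>f t\<bar> \<partial>lborel)"
      using integral_abs_bound[of lborel f] by simp
    also have "\<dots> \<le> integral\<^sup>L lborel g"
    proof (rule integral_mono)
      show "\<bar>f t\<bar> \<le> g t" for t unfolding f_def by (rule bound)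
    qed (use int_f int_g in auto)
    finally show ?thesis using g by simp
  qed
  moreover have "openin (prod_topology Y Y) (N \<times> N')" using N N' by (simp add: openin_prod_Times_iff)
  ultimately show "\<exists>U. openin (prod_topology Y Y) U \<and> w \<in> U \<and> (\<forall>v\<in>U. \<bar>hm p v - hm p w\<bar> < e)"
    using N N' yz(1) by (intro exI[of _ "N \<times> N'"]) auto
qed

section \<open>Values of the step map over a compact set\<close>

definition support :: "'a set \<Rightarrow> 'a set" where
  "support C = (\<Union>y\<in>C. h y ` {0..<1})"

lemma support_memI: "y \<in> C \<Longrightarrow> t \<in> {0..<1} \<Longrightarrow> h y t \<in> support C"
  unfolding support_def by blast

lemma support_subset: "C \<subseteq> topspace Y \<Longrightarrow> support C \<subseteq> X"
  unfolding support_def using h_in by auto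

lemma finite_support: "finite C \<Longrightarrow> C \<subseteq> topspace Y \<Longrightarrow> finite (support C)"
  unfolding support_def using h_finite by auto

text \<open>Near a point of \<open>X\<close> the values stay in one member of the cover, and near a
  point off \<open>X\<close> there are only finitely many of them. So locally finitely many members
  suffice, and compactness of \<open>C\<close> does the rest.\<close>

lemma compactin_support:
  assumes C: "compactin Y C"
  shows "compactin Y (support C)"
  unfolding compactin_def
proof (intro conjI allI impI)
  have CY: "C \<subseteq> topspace Y" using C by (rule compactin_subset_topspace)
  show "support C \<subseteq> topspace Y" using support_subset[OF CY] X_subset by blast
  fix \<U> assume \<U>: "(\<forall>U\<in>\<U>. openin Y U) \<and> support C \<subseteq> \<Union>\<U>"
  have "\<exists>N \<F>. openin Y N \<and> y \<in> N \<and> finite \<F> \<and> \<F> \<subseteq> \<U> \<and> support (N \<inter> C) \<subseteq> \<Union>\<F>"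
    if y: "y \<in> C" for y
  proof (cases "y \<in> X")
    case True
    \<comment> \<open>Any parameter would serve, as \<open>h y\<close> is constant here; the point
      is that \<open>y\<close> itself is covered.\<close>
    have "h y 0 \<in> support C" using y unfolding support_def by force
    then obtain U where U: "U \<in> \<U>" "y \<in> U" using \<U> h_fixed[OF True] by auto
    then obtain N where N: "openin Y N" "y \<in> N" "\<forall>z\<in>N. \<forall>t\<in>{0..<1}. h z t \<in> U"
      using h_nbhd[OF True, of U] \<U> by blast
    then have "support (N \<inter> C) \<subseteq> \<Union>{U}" unfolding support_def by auto
    then show ?thesis using N U by (intro exI[of _ N] exI[of _ "{U}"]) simp
  next
    case False
    then have y': "y \<in> topspace Y - X" using y CY by auto
    obtain F N where N: "finite F" "openin Y N" "y \<in> N" "\<forall>z\<in>N. \<forall>t\<in>{0..<1}. h z t \<in> F"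
      using h_local[OF y'] by blast
    have "support (N \<inter> C) \<subseteq> F" using N(4) unfolding support_def by auto
    then have fin: "finite (support (N \<inter> C))" using N(1) finite_subset by blast
    have "support (N \<inter> C) \<subseteq> support C" unfolding support_def by auto
    then have "\<forall>x\<in>support (N \<inter> C). \<exists>U. U \<in> \<U> \<and> x \<in> U" using \<U> by blast
    then obtain G where G: "\<forall>x\<in>support (N \<inter> C). G x \<in> \<U> \<and> x \<in> G x" by metis
    then have "support (N \<inter> C) \<subseteq> \<Union>(G ` support (N \<inter> C))" "G ` support (N \<inter> C) \<subseteq> \<U>" by auto
    then show ?thesis using N fin by (intro exI[of _ N] exI[of _ "G ` support (N \<inter> C)"]) simp
  qed
  then have "\<forall>y. \<exists>N\<F>. y \<in> C \<longrightarrow> openin Y (fst N\<F>) \<and> y \<in> fst N\<F> \<and> finite (snd N\<F>) \<and>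
      snd N\<F> \<subseteq> \<U> \<and> support (fst N\<F> \<inter> C) \<subseteq> \<Union>(snd N\<F>)"
    by fastforce
  then obtain N\<F> where N\<F>: "\<forall>y. y \<in> C \<longrightarrow> openin Y (fst (N\<F> y)) \<and> y \<in> fst (N\<F> y) \<and>
      finite (snd (N\<F> y)) \<and> snd (N\<F> y) \<subseteq> \<U> \<and> support (fst (N\<F> y) \<inter> C) \<subseteq> \<Union>(snd (N\<F> y))"
    by (rule choice[THEN exE])
  have "\<exists>\<G>. finite \<G> \<and> \<G> \<subseteq> (\<lambda>y. fst (N\<F> y)) ` C \<and> C \<subseteq> \<Union>\<G>"
    using N\<F> by (intro compactinD[OF C]) auto
  then obtain \<G> where \<G>: "finite \<G>" "\<G> \<subseteq> (\<lambda>y. fst (N\<F> y)) ` C" "C \<subseteq> \<Union>\<G>" by blast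
  obtain C' where C': "C' \<subseteq> C" "finite C'" "\<G> = (\<lambda>y. fst (N\<F> y)) ` C'"
    using finite_subset_image[OF \<G>(1,2)] by auto
  have "support C \<subseteq> \<Union>(\<Union>y\<in>C'. snd (N\<F> y))"
  proof
    fix x assume "x \<in> support C"
    then obtain z t where z: "z \<in> C" "t \<in> {0..<1}" "x = h z t" unfolding support_def by auto
    have "z \<in> \<Union>((\<lambda>y. fst (N\<F> y)) ` C')" using z(1) \<G>(3) C'(3) by auto
    then obtain y where y: "y \<in> C'" "z \<in> fst (N\<F> y)" by auto
    have "x \<in> support (fst (N\<F> y) \<inter> C)" using z y by (auto intro: support_memI)
    moreover have "support (fst (N\<F> y) \<inter> C) \<subseteq> \<Union>(snd (N\<F> y))" using N\<F> y C'(1) by auto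
    ultimately obtain V where "V \<in> snd (N\<F> y)" "x \<in> V" by blast
    then show "x \<in> \<Union>(\<Union>y\<in>C'. snd (N\<F> y))" using y(1) by blast
  qed
  moreover have "finite (\<Union>y\<in>C'. snd (N\<F> y))" "(\<Union>y\<in>C'. snd (N\<F> y)) \<subseteq> \<U>"
    using N\<F> C' by auto
  ultimately show "\<exists>\<F>. finite \<F> \<and> \<F> \<subseteq> \<U> \<and> support C \<subseteq> \<Union>\<F>"
    by (intro exI[of _ "\<Union>y\<in>C'. snd (N\<F> y)"]) simp
qed

lemma hm_diff_le_support:
  assumes "y \<in> C" "z \<in> C" "C \<subseteq> topspace Y"
    and "\<And>x x'. x \<in> support C \<Longrightarrow> x' \<in> support C \<Longrightarrow> \<bar>p (x, x') - q (x, x')\<bar> \<le> e"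
  shows "\<bar>hm p (y, z) - hm q (y, z)\<bar> \<le> e"
proof (rule hm_diff_le)
  show "\<bar>p (h y t, h z t) - q (h y t, h z t)\<bar> \<le> e" if "t \<in> {0..<1}" for t
    by (intro assms(4) support_memI assms(1,2) that)
qed (use assms in auto)

end

section \<open>The extension operator\<close>

lemma compact_open_nbhd:
  assumes L: "compactin W L" and p0: "p0 \<in> cont_real W" and d: "d > 0"
  shows "\<exists>V. openin (compact_open_topology W) V \<and> p0 \<in> V \<and> (\<forall>p\<in>V. \<forall>w\<in>L. \<bar>p w - p0 w\<bar> < d)"
proof -
  have c: "continuous_map W euclideanreal p0" using p0 by (simp add: cont_real_def)
  have "compact (p0 ` L)" using image_compactin[OF L c] by simp
  then have "\<forall>e>0. \<exists>R. finite R \<and> p0 ` L \<subseteq> (\<Union>r\<in>R. ball r e)"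
    unfolding compact_eq_totally_bounded by (rule conjunct2)
  then obtain R where R: "finite R" "p0 ` L \<subseteq> (\<Union>r\<in>R. ball r (d / 4))"
    using d by (elim allE[of _ "d / 4"]) auto
  \<comment> \<open>A subbasic set puts the values on a compact set into one open set, so
    \<open>L\<close> is cut into pieces where \<open>p0\<close> is almost constant. Closed intervals
    keep the pieces compact, and on a piece a function in \<open>B r\<close> differs from
    \<open>p0\<close> by less than \<open>d / 2 + d / 4\<close>.\<close>
  define K where "K r = L \<inter> {w \<in> topspace W. p0 w \<in> {r - d / 4..r + d / 4}}" for r
  have K: "compactin W (K r)" for r
    unfolding K_def by (intro compact_Int_closedin L closedin_continuous_map_preimage[OF c]) simp
  define B where "B r = {f \<in> cont_real W. f ` K r \<subseteq> {r - d / 2<..<r + d / 2}}" for r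
  have B: "openin (compact_open_topology W) (B r)" for r
    unfolding compact_open_topology_def
  proof (rule topology_generated_by_Basis)
    show "B r \<in> {{f \<in> cont_real W. f ` K \<subseteq> U} |K U. compactin W K \<and> open U}"
      unfolding B_def using K[of r] open_greaterThanLessThan by blast
  qed
  define V where "V = topspace (compact_open_topology W) \<inter> (\<Inter>r\<in>R. B r)"
  have "openin (compact_open_topology W) V"
    unfolding V_def using R B by (intro openin_Inter_finite)
  moreover have "p0 \<in> B r" for r
  proof -
    have "p0 w \<in> {r - d / 2<..<r + d / 2}" if "w \<in> K r" for w
      using that d unfolding K_def by simp
    then show ?thesis unfolding B_def using p0 by blast
  qed
  then have "p0 \<in> V" unfolding V_def using p0 by (simp add: topspace_compact_open_topology)
  moreover have "\<bar>p w - p0 w\<bar> < d" if p: "p \<in> V" and w: "w \<in> L" for p w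
  proof -
    have "p0 w \<in> (\<Union>r\<in>R. ball r (d / 4))" using R(2) w by blast
    then obtain r where r: "r \<in> R" "\<bar>r - p0 w\<bar> < d / 4" by (auto simp: dist_real_def)
    have "w \<in> topspace W" using w L compactin_subset_topspace by blast
    moreover have "r - d / 4 \<le> p0 w" "p0 w \<le> r + d / 4" using r(2) by linarith+
    ultimately have "w \<in> K r" unfolding K_def using w by simp
    moreover have "p \<in> B r" using p r(1) unfolding V_def by blast
    ultimately have "p w \<in> {r - d / 2<..<r + d / 2}" unfolding B_def by blast
    then show ?thesis using r(2) unfolding greaterThanLessThan_iff by linarith
  qed
  ultimately show ?thesis by (intro exI[of _ V]) simp
qed

lemma pointwise_nbhd:
  assumes L: "finite L" "L \<subseteq> topspace W" and p0: "p0 \<in> cont_real W" and d: "d > 0"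
  shows "\<exists>V. openin (pointwise_topology W) V \<and> p0 \<in> V \<and> (\<forall>p\<in>V. \<forall>w\<in>L. \<bar>p w - p0 w\<bar> < d)"
proof -
  define B where "B w = {p \<in> topspace (pointwise_topology W). p w \<in> {p0 w - d<..<p0 w + d}}" for w
  have B: "openin (pointwise_topology W) (B w)" if "w \<in> L" for w
  proof -
    have "continuous_map (pointwise_topology W) euclideanreal (\<lambda>p. p w)"
      unfolding pointwise_topology_def using that L
      by (intro continuous_map_from_subtopology continuous_map_product_projection) auto
    then show ?thesis unfolding B_def by (rule openin_continuous_map_preimage) simp
  qed
  define V where "V = topspace (pointwise_topology W) \<inter> (\<Inter>w\<in>L. B w)"
  have "openin (pointwise_topology W) V" unfolding V_def using L B by (intro openin_Inter_finite)
  moreover have "p0 \<in> V" unfolding V_def B_def using p0 d by (simp add: topspace_pointwise_topology)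
  moreover have "\<bar>p w - p0 w\<bar> < d" if p: "p \<in> V" and w: "w \<in> L" for p w
  proof -
    have "p \<in> B w" using p w unfolding V_def by blast
    then show ?thesis by (simp add: B_def abs_less_iff)
  qed
  ultimately show ?thesis by (intro exI[of _ V]) simp
qed

section \<open>Averaging over the group\<close>

locale equivariant_step_map = compact_group G TG + step_map Y X h
  for G :: "('g, 'm) monoid_scheme" (structure) and TG :: "'g topology"
    and Y :: "'a topology" and X h +
  fixes \<phi> :: "'g \<Rightarrow> 'a \<Rightarrow> 'a"
  assumes G_space: "G_space G TG \<phi> Y" and invariant: "invariant_subset G \<phi> X"
begin

abbreviation "CX \<equiv> C_inv G \<phi> (subtopology Y X)"
abbreviation "CY \<equiv> C_inv G \<phi> Y"

lemma topspace_X: "topspace (subtopology Y X) = X"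
  using X_subset by auto

lemma act_in: "g \<in> carrier G \<Longrightarrow> y \<in> topspace Y \<Longrightarrow> \<phi> g y \<in> topspace Y"
  using G_space group_action.element_image unfolding G_space_def by metis

lemma act_in_X: "g \<in> carrier G \<Longrightarrow> x \<in> X \<Longrightarrow> \<phi> g x \<in> X"
  using invariant unfolding invariant_subset_def by blast

lemma act_mult:
  assumes "g \<in> carrier G" "k \<in> carrier G" "y \<in> topspace Y"
  shows "\<phi> (g \<otimes> k) y = \<phi> g (\<phi> k y)"
proof -
  have "group_action G (topspace Y) \<phi>" using G_space by (simp add: G_space_def)
  from group_action.composition_rule[OF this assms(3,1,2)] show ?thesis .
qed

lemma continuous_map_act:
  assumes "continuous_map Z TG u" "continuous_map Z Y v"
  shows "continuous_map Z Y (\<lambda>z. \<phi> (u z) (v z))"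
proof -
  have "continuous_map (prod_topology TG Y) Y (\<lambda>(g, y). \<phi> g y)"
    using G_space by (simp add: G_space_def)
  from continuous_map_compose[OF continuous_map_pairedI[OF assms] this] show ?thesis
    by (simp add: o_def)
qed

lemma CX_D:
  assumes "p \<in> CX"
  shows "continuous_map (prod_topology (subtopology Y X) (subtopology Y X)) euclideanreal p"
    "p \<in> extensional (X \<times> X)"
    "\<And>g x y. g \<in> carrier G \<Longrightarrow> x \<in> X \<Longrightarrow> y \<in> X \<Longrightarrow> p (\<phi> g x, \<phi> g y) = p (x, y)"
  using assms unfolding C_inv_def cont_real_def by (auto simp: Int_absorb1[OF X_subset])

definition T :: "('a \<times> 'a \<Rightarrow> real) \<Rightarrow> 'a \<times> 'a \<Rightarrow> real" where
  "T p = (\<lambda>w\<in>topspace Y \<times> topspace Y. haar (\<lambda>g. hm p (\<phi> g (fst w), \<phi> g (snd w))))"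

lemma T_eq:
  "y \<in> topspace Y \<Longrightarrow> z \<in> topspace Y \<Longrightarrow> T p (y, z) = haar (\<lambda>g. hm p (\<phi> g y, \<phi> g z))"
  by (simp add: T_def)

lemma T_extensional: "T p \<in> extensional (topspace Y \<times> topspace Y)"
  by (simp add: T_def)

lemma continuous_map_hm_act:
  assumes "p \<in> CX"
  shows "continuous_map (prod_topology TG (prod_topology Y Y)) euclideanreal
    (\<lambda>v. hm p (\<phi> (fst v) (fst (snd v)), \<phi> (fst v) (snd (snd v))))"
proof -
  have "continuous_map (prod_topology TG (prod_topology Y Y)) (prod_topology Y Y)
    (\<lambda>v. (\<phi> (fst v) (fst (snd v)), \<phi> (fst v) (snd (snd v))))"
    by (intro continuous_map_pairedI continuous_map_act continuous_map_fst
        continuous_map_compose[OF continuous_map_snd continuous_map_fst, unfolded o_def]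
        continuous_map_compose[OF continuous_map_snd continuous_map_snd, unfolded o_def])
  from continuous_map_compose[OF this continuous_map_hm[OF CX_D(1)[OF assms]]]
  show ?thesis by (simp add: o_def)
qed

lemma continuous_map_hm_orbit:
  assumes p: "p \<in> CX" and yz: "y \<in> topspace Y" "z \<in> topspace Y"
  shows "continuous_map TG euclideanreal (\<lambda>g. hm p (\<phi> g y, \<phi> g z))"
proof -
  have "continuous_map TG (prod_topology TG (prod_topology Y Y)) (\<lambda>g. (g, (y, z)))"
    using yz by (intro continuous_map_pairedI) auto
  from continuous_map_compose[OF this continuous_map_hm_act[OF p]]
  show ?thesis by (simp add: o_def)
qed

lemma T_in:
  assumes p: "p \<in> CX"
  shows "T p \<in> CY"
proof -
  have "continuous_map (prod_topology Y Y) euclideanreal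
      (\<lambda>w. haar (\<lambda>g. hm p (\<phi> g (fst w), \<phi> g (snd w))))"
    using continuous_map_haar[OF continuous_map_hm_act[OF p]] by simp
  then have "continuous_map (prod_topology Y Y) euclideanreal (T p)"
    by (rule continuous_map_eq) (simp add: T_def)
  moreover have "T p (\<phi> k y, \<phi> k z) = T p (y, z)"
    if k: "k \<in> carrier G" and yz: "y \<in> topspace Y" "z \<in> topspace Y" for k y z
  proof -
    have "T p (\<phi> k y, \<phi> k z) = haar (\<lambda>g. hm p (\<phi> g (\<phi> k y), \<phi> g (\<phi> k z)))"
      using act_in k yz by (simp add: T_eq)
    also have "\<dots> = haar (\<lambda>g. hm p (\<phi> (g \<otimes> k) y, \<phi> (g \<otimes> k) z))"
      using k yz by (intro haar_cong continuous_map_hm_orbit p act_in) (simp_all add: act_mult)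
    also have "\<dots> = haar (\<lambda>g. hm p (\<phi> g y, \<phi> g z))"
      by (rule haar_right_translate[OF continuous_map_hm_orbit[OF p yz] k])
    finally show ?thesis using yz by (simp add: T_eq)
  qed
  ultimately show ?thesis
    using T_extensional by (simp add: C_inv_def cont_real_def)
qed

text \<open>The orbit of a pair in \<open>X\<close> stays in \<open>X\<close>, where
  \<open>hm p\<close> is \<open>p\<close>; invariance of \<open>p\<close> makes the averaged
  function constant in \<open>g\<close>.\<close>

lemma T_extends:
  assumes p: "p \<in> CX"
  shows "restrict (T p) (X \<times> X) = p"
proof (rule extensionalityI)
  show "restrict (T p) (X \<times> X) \<in> extensional (X \<times> X)" by simp
  show "p \<in> extensional (X \<times> X)" by (rule CX_D(2)[OF p])
  fix w assume "w \<in> X \<times> X"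
  then obtain x y where w: "w = (x, y)" "x \<in> X" "y \<in> X" by auto
  then have xy: "x \<in> topspace Y" "y \<in> topspace Y" using X_subset by auto
  have "haar (\<lambda>g. hm p (\<phi> g x, \<phi> g y)) = haar (\<lambda>g. p (x, y))"
    by (intro haar_cong continuous_map_hm_orbit p xy)
      (simp add: hm_fixed act_in_X w CX_D(3)[OF p])
  then show "restrict (T p) (X \<times> X) w = p w" using w xy by (simp add: T_eq haar_const)
qed

lemma hm_restrict:
  assumes "g \<in> carrier G" "y \<in> topspace Y" "z \<in> topspace Y"
  shows "hm (restrict p (X \<times> X)) (\<phi> g y, \<phi> g z) = hm p (\<phi> g y, \<phi> g z)"
  using assms by (intro hm_cong act_in) auto

lemma T_add:
  assumes p: "p \<in> CX" and q: "q \<in> CX"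
  shows "T (\<lambda>w\<in>X \<times> X. p w + q w) = (\<lambda>w\<in>topspace Y \<times> topspace Y. T p w + T q w)"
proof (rule extensionalityI[OF T_extensional])
  fix w assume "w \<in> topspace Y \<times> topspace Y"
  then obtain y z where w: "w = (y, z)" and yz: "y \<in> topspace Y" "z \<in> topspace Y" by auto
  have c: "continuous_map TG euclideanreal (\<lambda>g. hm p (\<phi> g y, \<phi> g z))"
    "continuous_map TG euclideanreal (\<lambda>g. hm q (\<phi> g y, \<phi> g z))"
    using continuous_map_hm_orbit p q yz by auto
  have "haar (\<lambda>g. hm p (\<phi> g y, \<phi> g z) + hm q (\<phi> g y, \<phi> g z)) =
      haar (\<lambda>g. hm (\<lambda>w\<in>X \<times> X. p w + q w) (\<phi> g y, \<phi> g z))"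
  proof (rule haar_cong)
    show "continuous_map TG euclideanreal (\<lambda>g. hm p (\<phi> g y, \<phi> g z) + hm q (\<phi> g y, \<phi> g z))"
      using c by (rule continuous_map_add)
    fix g assume g: "g \<in> carrier G"
    show "hm p (\<phi> g y, \<phi> g z) + hm q (\<phi> g y, \<phi> g z) = hm (\<lambda>w\<in>X \<times> X. p w + q w) (\<phi> g y, \<phi> g z)"
      using hm_restrict[OF g yz, of "\<lambda>w. p w + q w"] hm_add act_in g yz by simp
  qed
  then show "T (\<lambda>w\<in>X \<times> X. p w + q w) w = (\<lambda>w\<in>topspace Y \<times> topspace Y. T p w + T q w) w"
    using haar_add[OF c] yz w by (simp add: T_eq)
qed simp

lemma T_cmult:
  assumes p: "p \<in> CX"
  shows "T (\<lambda>w\<in>X \<times> X. c * p w) = (\<lambda>w\<in>topspace Y \<times> topspace Y. c * T p w)"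
proof (rule extensionalityI[OF T_extensional])
  fix w assume "w \<in> topspace Y \<times> topspace Y"
  then obtain y z where w: "w = (y, z)" and yz: "y \<in> topspace Y" "z \<in> topspace Y" by auto
  have cont: "continuous_map TG euclideanreal (\<lambda>g. hm p (\<phi> g y, \<phi> g z))"
    using continuous_map_hm_orbit p yz by auto
  have "haar (\<lambda>g. c * hm p (\<phi> g y, \<phi> g z)) = haar (\<lambda>g. hm (\<lambda>w\<in>X \<times> X. c * p w) (\<phi> g y, \<phi> g z))"
  proof (rule haar_cong)
    show "continuous_map TG euclideanreal (\<lambda>g. c * hm p (\<phi> g y, \<phi> g z))"
      using cont by (intro continuous_map_real_mult) auto
    fix g assume g: "g \<in> carrier G"
    show "c * hm p (\<phi> g y, \<phi> g z) = hm (\<lambda>w\<in>X \<times> X. c * p w) (\<phi> g y, \<phi> g z)"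
      using hm_restrict[OF g yz, of "\<lambda>w. c * p w"] hm_cmult by simp
  qed
  then show "T (\<lambda>w\<in>X \<times> X. c * p w) w = (\<lambda>w\<in>topspace Y \<times> topspace Y. c * T p w) w"
    using haar_cmult[OF cont] yz w by (simp add: T_eq)
qed simp

lemma T_one: "T (\<lambda>w\<in>X \<times> X. 1) = (\<lambda>w\<in>topspace Y \<times> topspace Y. 1)"
proof (rule extensionalityI[OF T_extensional])
  fix w assume "w \<in> topspace Y \<times> topspace Y"
  then obtain y z where w: "w = (y, z)" and yz: "y \<in> topspace Y" "z \<in> topspace Y" by auto
  have "haar (\<lambda>g. 1) = haar (\<lambda>g. hm (\<lambda>w\<in>X \<times> X. 1) (\<phi> g y, \<phi> g z))"
  proof (rule haar_cong)
    fix g assume g: "g \<in> carrier G"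
    show "1 = hm (\<lambda>w\<in>X \<times> X. 1) (\<phi> g y, \<phi> g z)"
      using hm_restrict[OF g yz, of "\<lambda>w. 1"] by (simp add: hm_const)
  qed simp
  then show "T (\<lambda>w\<in>X \<times> X. 1) w = (\<lambda>w\<in>topspace Y \<times> topspace Y. 1) w"
    using yz w by (simp add: T_eq haar_const)
qed simp

lemma T_nonneg:
  assumes p: "p \<in> CX" and pos: "\<forall>w\<in>X \<times> X. 0 \<le> p w" and w: "w \<in> topspace Y \<times> topspace Y"
  shows "0 \<le> T p w"
proof -
  obtain y z where w: "w = (y, z)" and yz: "y \<in> topspace Y" "z \<in> topspace Y" using w by auto
  have "haar (\<lambda>g. 0) \<le> haar (\<lambda>g. hm p (\<phi> g y, \<phi> g z))"
  proof (intro haar_mono continuous_map_hm_orbit p yz)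
    fix g assume g: "g \<in> carrier G"
    have "hm (\<lambda>_. 0) (\<phi> g y, \<phi> g z) \<le> hm p (\<phi> g y, \<phi> g z)"
      using pos h_in act_in[OF g] yz by (intro hm_mono) auto
    then show "0 \<le> hm p (\<phi> g y, \<phi> g z)" by (simp add: hm_const)
  qed simp
  then show ?thesis using w yz by (simp add: T_eq haar_const)
qed

lemma T_regular: "regular_operator CX (X \<times> X) (topspace Y \<times> topspace Y) T"
  unfolding regular_operator_def linear_operator_def
  using T_add T_cmult T_one T_nonneg by simp

lemma pseudometric_on_T:
  assumes p: "p \<in> CX" and pm: "pseudometric_on X p"
  shows "pseudometric_on (topspace Y) (T p)"
proof -
  have hm: "pseudometric_on (topspace Y) (hm p)" by (rule pseudometric_on_hm[OF pm])
  have pos: "0 \<le> hm p (x, y)" and sym: "hm p (x, y) = hm p (y, x)"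
    if "x \<in> topspace Y" "y \<in> topspace Y" for x y
    using hm that unfolding pseudometric_on_def by simp_all
  have zero: "hm p (x, x) = 0" if "x \<in> topspace Y" for x
    using hm that unfolding pseudometric_on_def by simp
  have triangle: "hm p (x, z) \<le> hm p (x, y) + hm p (y, z)"
    if "x \<in> topspace Y" "y \<in> topspace Y" "z \<in> topspace Y" for x y z
    using hm that unfolding pseudometric_on_def by simp
  note cont = continuous_map_hm_orbit[OF p]
  have "0 \<le> T p (x, y)" if "x \<in> topspace Y" "y \<in> topspace Y" for x y
  proof -
    have "haar (\<lambda>g. 0) \<le> haar (\<lambda>g. hm p (\<phi> g x, \<phi> g y))"
      using that by (intro haar_mono cont pos act_in) simp_all
    then show ?thesis using that by (simp add: T_eq haar_const)
  qed
  moreover have "T p (x, x) = 0" if "x \<in> topspace Y" for x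
  proof -
    have "haar (\<lambda>g. hm p (\<phi> g x, \<phi> g x)) = haar (\<lambda>g. 0)"
      using that by (intro haar_cong cont zero act_in)
    then show ?thesis using that by (simp add: T_eq haar_const)
  qed
  moreover have "T p (x, y) = T p (y, x)" if "x \<in> topspace Y" "y \<in> topspace Y" for x y
  proof -
    have "haar (\<lambda>g. hm p (\<phi> g x, \<phi> g y)) = haar (\<lambda>g. hm p (\<phi> g y, \<phi> g x))"
      using that by (intro haar_cong cont sym act_in)
    then show ?thesis using that by (simp add: T_eq)
  qed
  moreover have "T p (x, z) \<le> T p (x, y) + T p (y, z)"
    if xyz: "x \<in> topspace Y" "y \<in> topspace Y" "z \<in> topspace Y" for x y z
  proof -
    have "haar (\<lambda>g. hm p (\<phi> g x, \<phi> g z)) \<le> haar (\<lambda>g. hm p (\<phi> g x, \<phi> g y) + hm p (\<phi> g y, \<phi> g z))"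
      using xyz by (intro haar_mono continuous_map_add cont triangle act_in)
    also have "\<dots> = haar (\<lambda>g. hm p (\<phi> g x, \<phi> g y)) + haar (\<lambda>g. hm p (\<phi> g y, \<phi> g z))"
      using xyz by (intro haar_add cont)
    finally show ?thesis using xyz by (simp add: T_eq)
  qed
  ultimately show ?thesis unfolding pseudometric_on_def by simp
qed

section \<open>Continuity of the operator\<close>

definition orbit :: "'a set \<Rightarrow> 'a set" where
  "orbit A = (\<lambda>v. \<phi> (fst v) (snd v)) ` (carrier G \<times> A)"

lemma orbit_subset: "A \<subseteq> topspace Y \<Longrightarrow> orbit A \<subseteq> topspace Y"
  unfolding orbit_def using act_in by auto

lemma orbit_memI: "g \<in> carrier G \<Longrightarrow> a \<in> A \<Longrightarrow> \<phi> g a \<in> orbit A"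
  unfolding orbit_def by force

lemma compactin_orbit:
  assumes "compactin Y A"
  shows "compactin Y (orbit A)"
  unfolding orbit_def
proof (rule image_compactin)
  have "compactin TG (carrier G)" using compact by (simp add: compact_space_def topspace_TG)
  then show "compactin (prod_topology TG Y) (carrier G \<times> A)" using assms by (simp add: compactin_Times)
  show "continuous_map (prod_topology TG Y) Y (\<lambda>v. \<phi> (fst v) (snd v))"
    by (intro continuous_map_act continuous_map_fst continuous_map_snd)
qed

text \<open>
  Both continuity claims rest on this estimate: the support of the orbit of a compact set is
  compact, and if \<open>G\<close> is finite, the support of the orbit of a finite set is finite.
\<close>

lemma T_diff_le:
  assumes p: "p \<in> CX" and q: "q \<in> CX" and A: "A \<subseteq> topspace Y" and w: "w \<in> A \<times> A"
    and e: "\<And>v. v \<in> support (orbit A) \<times> support (orbit A) \<Longrightarrow> \<bar>p v - q v\<bar> \<le> e"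
  shows "\<bar>T p w - T q w\<bar> \<le> e"
proof -
  obtain y z where w: "w = (y, z)" and yz: "y \<in> A" "z \<in> A" using w by auto
  then have Y: "y \<in> topspace Y" "z \<in> topspace Y" using A by auto
  have "\<bar>haar (\<lambda>g. hm p (\<phi> g y, \<phi> g z)) - haar (\<lambda>g. hm q (\<phi> g y, \<phi> g z))\<bar> \<le> e"
  proof (intro haar_abs_diff_le continuous_map_hm_orbit p q Y)
    fix g assume g: "g \<in> carrier G"
    show "\<bar>hm p (\<phi> g y, \<phi> g z) - hm q (\<phi> g y, \<phi> g z)\<bar> \<le> e"
      by (rule hm_diff_le_support[OF orbit_memI[OF g yz(1)] orbit_memI[OF g yz(2)] orbit_subset[OF A]])
        (simp add: e)
  qed
  then show ?thesis using w Y by (simp add: T_eq)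
qed

lemma T_in_cont_real: "p \<in> CX \<Longrightarrow> T p \<in> cont_real (prod_topology Y Y)"
  using T_in by (simp add: C_inv_def)

lemma T_continuous_compact_open:
  "continuous_map (C_inv_co G \<phi> (subtopology Y X)) (C_inv_co G \<phi> Y) T"
proof -
  let ?P = "prod_topology (subtopology Y X) (subtopology Y X)"
  let ?C = "C_inv_co G \<phi> (subtopology Y X)"
  have "continuous_map ?C (compact_open_topology (prod_topology Y Y)) T"
    unfolding compact_open_topology_def
  proof (rule continuous_on_generated_topo)
    fix B assume "B \<in> {{f \<in> cont_real (prod_topology Y Y). f ` K \<subseteq> U} |K U.
      compactin (prod_topology Y Y) K \<and> open U}"
    then obtain K U where K: "compactin (prod_topology Y Y) K" and U: "open U"
      and B: "B = {f \<in> cont_real (prod_topology Y Y). f ` K \<subseteq> U}" by auto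
    have "\<exists>V. openin ?C V \<and> p0 \<in> V \<and> V \<subseteq> T -` B \<inter> topspace ?C"
      if p0: "p0 \<in> T -` B \<inter> topspace ?C" for p0
    proof -
      have p0X: "p0 \<in> CX" using p0 by (simp add: topspace_C_inv_co)
      have "continuous_map (prod_topology Y Y) euclideanreal (T p0)"
        using T_in_cont_real[OF p0X] by (simp add: cont_real_def)
      from image_compactin[OF K this] have "compact (T p0 ` K)" by simp
      moreover have "T p0 ` K \<subseteq> U" using p0 B by simp
      \<comment> \<open>The image of \<open>K\<close> is compact inside the open \<open>U\<close>,
        hence has a uniform margin.\<close>
      ultimately obtain e where e: "e > 0" "(\<Union>r\<in>T p0 ` K. ball r e) \<subseteq> U"
        using U compact_subset_open_imp_ball_epsilon_subset[of "T p0 ` K" U] by blast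
      \<comment> \<open>\<open>K\<close> need not be a product; its two projections together give a
        compact \<open>A\<close> with \<open>K\<close> inside \<open>A \<times> A\<close>.\<close>
      define A where "A = fst ` K \<union> snd ` K"
      have A: "compactin Y A"
        unfolding A_def using image_compactin[OF K continuous_map_fst] image_compactin[OF K continuous_map_snd]
        by (rule compactin_Un)
      have AY: "A \<subseteq> topspace Y" using A by (rule compactin_subset_topspace)
      let ?S = "support (orbit A)"
      have "compactin (subtopology Y X) ?S"
        using compactin_support[OF compactin_orbit[OF A]] support_subset[OF orbit_subset[OF AY]]
        by (simp add: compactin_subtopology)
      then have "compactin ?P (?S \<times> ?S)" by (simp add: compactin_Times)
      moreover have "p0 \<in> cont_real ?P" using p0X by (simp add: C_inv_def)
      \<comment> \<open>Half of \<open>e\<close>, since the estimate through the mean yields only a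
        weak inequality.\<close>
      ultimately obtain V where V: "openin (compact_open_topology ?P) V" "p0 \<in> V"
        "\<forall>p\<in>V. \<forall>v\<in>?S \<times> ?S. \<bar>p v - p0 v\<bar> < e / 2"
        using compact_open_nbhd[of ?P "?S \<times> ?S" p0 "e / 2"] e(1) by auto
      have "p \<in> T -` B" if pV: "p \<in> V" and p: "p \<in> CX" for p
      proof -
        have "T p w \<in> U" if w: "w \<in> K" for w
        proof -
          have "fst w \<in> A" "snd w \<in> A" using w unfolding A_def by auto
          then have wA: "w \<in> A \<times> A" by (simp add: mem_Times_iff)
          have "\<bar>T p w - T p0 w\<bar> \<le> e / 2"
            by (rule T_diff_le[OF p p0X AY wA]) (rule less_imp_le, use V(3) pV in blast)
          then have "T p w \<in> ball (T p0 w) e" using e(1) by (simp add: dist_real_def abs_minus_commute)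
          then show ?thesis using e(2) w by blast
        qed
        then show ?thesis using T_in_cont_real[OF p] B by auto
      qed
      then have "V \<inter> CX \<subseteq> T -` B \<inter> topspace ?C" by (auto simp: topspace_C_inv_co)
      moreover have "openin ?C (V \<inter> CX)"
        unfolding C_inv_co_def using V(1) by (rule openin_subtopology_Int)
      ultimately show ?thesis using V(2) p0X by (intro exI[of _ "V \<inter> CX"]) simp
    qed
    then show "openin ?C (T -` B \<inter> topspace ?C)" by (subst openin_subopen) blast
  next
    have "cont_real (prod_topology Y Y) \<subseteq>
      \<Union>{{f \<in> cont_real (prod_topology Y Y). f ` K \<subseteq> U} |K U. compactin (prod_topology Y Y) K \<and> open U}"
      using topspace_compact_open_topology[of "prod_topology Y Y"]
      unfolding compact_open_topology_def topology_generated_by_topspace by simp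
    moreover have "T ` topspace ?C \<subseteq> cont_real (prod_topology Y Y)"
      using T_in_cont_real by (auto simp: topspace_C_inv_co)
    ultimately show "T ` topspace ?C \<subseteq>
      \<Union>{{f \<in> cont_real (prod_topology Y Y). f ` K \<subseteq> U} |K U. compactin (prod_topology Y Y) K \<and> open U}"
      by blast
  qed
  then show ?thesis
    unfolding C_inv_co_def[of G \<phi> Y] continuous_map_in_subtopology
    using T_in by (auto simp: topspace_C_inv_co)
qed

lemma T_continuous_pointwise:
  assumes G: "finite (carrier G)"
  shows "continuous_map (C_inv_pw G \<phi> (subtopology Y X)) (C_inv_pw G \<phi> Y) T"
proof -
  let ?P = "prod_topology (subtopology Y X) (subtopology Y X)"
  let ?C = "C_inv_pw G \<phi> (subtopology Y X)"
  have "continuous_map ?C euclideanreal (\<lambda>p. T p w)" if w: "w \<in> topspace Y \<times> topspace Y" for w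
    unfolding continuous_map_real_iff
  proof (intro ballI allI impI)
    fix p0 and e :: real assume "p0 \<in> topspace ?C" and e: "e > 0"
    then have p0: "p0 \<in> CX" by (simp add: topspace_C_inv_pw)
    define A where "A = {fst w, snd w}"
    have AY: "A \<subseteq> topspace Y" and wA: "w \<in> A \<times> A" using w by (auto simp: A_def)
    let ?S = "support (orbit A)"
    have "finite (orbit A)" unfolding orbit_def using G by (simp add: A_def)
    then have "finite ?S" using orbit_subset[OF AY] by (rule finite_support)
    moreover have "?S \<times> ?S \<subseteq> topspace ?P"
      using support_subset[OF orbit_subset[OF AY]] unfolding topspace_prod_topology topspace_X by blast
    moreover have "p0 \<in> cont_real ?P" using p0 by (simp add: C_inv_def)
    ultimately obtain V where V: "openin (pointwise_topology ?P) V" "p0 \<in> V"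
      "\<forall>p\<in>V. \<forall>v\<in>?S \<times> ?S. \<bar>p v - p0 v\<bar> < e / 2"
      using pointwise_nbhd[of "?S \<times> ?S" ?P p0 "e / 2"] e by auto
    have "openin ?C (V \<inter> CX)" unfolding C_inv_pw_def using V(1) by (rule openin_subtopology_Int)
    moreover have "\<bar>T p w - T p0 w\<bar> < e" if p: "p \<in> V \<inter> CX" for p
    proof -
      have pX: "p \<in> CX" using p by simp
      have "\<bar>T p w - T p0 w\<bar> \<le> e / 2"
        by (rule T_diff_le[OF pX p0 AY wA]) (rule less_imp_le, use V(3) p in blast)
      then show ?thesis using e by simp
    qed
    ultimately show "\<exists>U. openin ?C U \<and> p0 \<in> U \<and> (\<forall>p\<in>U. \<bar>T p w - T p0 w\<bar> < e)"
      using V(2) p0 by (intro exI[of _ "V \<inter> CX"]) simp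
  qed
  then have "continuous_map ?C (product_topology (\<lambda>_. euclideanreal) (topspace (prod_topology Y Y))) T"
    unfolding continuous_map_componentwise using T_extensional by auto
  then show ?thesis
    unfolding C_inv_pw_def[of G \<phi> Y] pointwise_topology_def[of "prod_topology Y Y"] continuous_map_in_subtopology
    using T_in T_in_cont_real by (auto simp: topspace_C_inv_pw)
qed

end

text \<open>For empty \<open>X\<close> the unit function on \<open>X \<times> X\<close> is the zero
  function, which no linear operator sends to 1 on a nonempty \<open>Y\<close>; hence
  \<open>X \<noteq> {}\<close>. Invariance of the extended pseudometrics is part of
  \<open>T p\<close> being in \<open>C_inv G \<phi> Y\<close>.\<close>

theorem theorem4p1:
  fixes G :: "('g, 'm) monoid_scheme" and TG :: "'g topology"
    and \<phi> :: "'g \<Rightarrow> 'a \<Rightarrow> 'a" and Y :: "'a topology" and X :: "'a set"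
  assumes "topological_group G TG" and "compact_space TG"
    and "stratifiable_space Y" and "G_space G TG \<phi> Y"
    and "closedin Y X" and "invariant_subset G \<phi> X" and "X \<noteq> {}"
  shows "\<exists>T :: ('a \<times> 'a \<Rightarrow> real) \<Rightarrow> ('a \<times> 'a \<Rightarrow> real).
           T \<in> C_inv G \<phi> (subtopology Y X) \<rightarrow> C_inv G \<phi> Y \<and>
           extension_operator (C_inv G \<phi> (subtopology Y X)) (X \<times> X) T \<and>
           regular_operator (C_inv G \<phi> (subtopology Y X)) (X \<times> X) (topspace Y \<times> topspace Y) T \<and>
           continuous_map (C_inv_co G \<phi> (subtopology Y X)) (C_inv_co G \<phi> Y) T \<and>
           (\<forall>p \<in> C_inv G \<phi> (subtopology Y X).
              pseudometric_on X p \<longrightarrow> pseudometric_on (topspace Y) (T p)) \<and>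
           (finite (carrier G) \<longrightarrow>
              continuous_map (C_inv_pw G \<phi> (subtopology Y X)) (C_inv_pw G \<phi> Y) T)"
proof -
  obtain S where "stratification Y S"
    using stratifiable_imp_stratification[OF assms(3)] .
  then obtain h where "step_map Y X h"
    using stratification.exists_step_map[OF _ assms(5,7)] by blast
  then interpret step_map Y X h .
  interpret equivariant_step_map G TG Y X h \<phi>
    using assms by unfold_locales
  show ?thesis
    using T_in T_extends T_regular T_continuous_compact_open pseudometric_on_T T_continuous_pointwise
    by (intro exI[of _ T]) (simp add: extension_operator_def)
qed

end
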